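(* Let $S=K[x_1,\dots,x_n]$ be a standard graded polynomial ring over a field $K$ and let $I\subset S$ be a nonzero proper graded ideal generated in a single degree. (a) For all $\mathfrak p\in\mathrm{Ass}^\infty(I)$ there exists an integer $b_{\mathfrak p}$ such that $\mathrm{v}_{\mathfrak p}(I^k)=\alpha(I)k+b_{\mathfrak p}$ for all $k\gg0$. (b) $\mathrm{v}(I^k)=\alpha(I)k+b$ for all $k\gg0$, where $b=\min_{\mathfrak p\in\mathrm{Ass}^\infty(I)}b_{\mathfrak p}$. (c) If $I$ is a monomial ideal, then $b\ge-1$ and $b_{\mathfrak p}\ge -1$ for all $\mathfrak p\in\mathrm{Ass}^\infty(I)$.
   Context: $S=\bigoplus_{d\ge0}S_d$ with $\deg x_i=1$. For a graded ideal $I\subset S$: $\mathrm{Ass}(I)$ denotes the set of associated primes of $S/I$; $\alpha(I)=\min\{d: I_d\neq 0\}$. For $\mathfrak p\in\mathrm{Ass}(I)$, $\mathrm{v}_{\mathfrak p}(I)=\min\{d: \exists f\in S_d \text{ with } (I:f)=\mathfrak p\}$, and $\mathrm{v}(I)=\min\{d: \exists f\in S_d\text{ with } (I:f)\in\mathrm{Ass}(I)\}$. By Brodmann, $\mathrm{Ass}(I^{k+1})=\mathrm{Ass}(I^k)$ for all $k\gg0$; $\mathrm{Ass}^\infty(I)$ (the set of stable primes of $I$) is the set of primes $\mathfrak p$ such that $\mathfrak p\in\mathrm{Ass}(I^k)$ for all $k\gg0$. "For all $k\gg 0$" means for all sufficiently large integers $k$. *)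

theory Defs
  imports
    Complex_Main
    "HOL-Library.Poly_Mapping"
    "HOL-Algebra.Ideal_Product"
    "HOL-Algebra.Algebraic_Closure_Type"
begin

text \<open>
  A polynomial over \<open>'k\<close> in the variables \<open>x\<^sub>i\<close> (\<open>i :: 'n\<close>) is a finitely supported map from
  exponent vectors \<open>'n \<Rightarrow>\<^sub>0 nat\<close> to coefficients; multiplication is the convolution product of
  \<open>HOL-Library.Poly_Mapping\<close>.  With \<open>'n\<close> finite this is \<open>K[x\<^sub>1,\<dots>,x\<^sub>n]\<close> for \<open>n = CARD('n)\<close>.
\<close>

type_synonym ('n, 'k) mpoly = "('n \<Rightarrow>\<^sub>0 nat) \<Rightarrow>\<^sub>0 'k"

abbreviation polyring :: "('n, 'k::field) mpoly ring"
  where "polyring \<equiv> ring_of_type_algebra"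

definition mon_deg :: "('n::finite \<Rightarrow>\<^sub>0 nat) \<Rightarrow> nat"
  where "mon_deg m = (\<Sum>i\<in>UNIV. Poly_Mapping.lookup m i)"

text \<open>The graded piece \<open>S\<^sub>d\<close>; it contains \<open>0\<close>.\<close>

definition graded_piece :: "nat \<Rightarrow> ('n::finite, 'k::field) mpoly set"
  where "graded_piece d = {f. \<forall>m\<in>Poly_Mapping.keys f. mon_deg m = d}"

definition hom_component :: "nat \<Rightarrow> ('n::finite, 'k::field) mpoly \<Rightarrow> ('n, 'k) mpoly"
  where "hom_component d f =
    (\<Sum>m\<in>{m \<in> Poly_Mapping.keys f. mon_deg m = d}.
       Poly_Mapping.single m (Poly_Mapping.lookup f m))"

text \<open>\<open>I = \<Oplus>\<^sub>d (I \<inter> S\<^sub>d)\<close>, i.e. \<open>I\<close> contains the homogeneous components of its elements.\<close>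

definition graded_ideal :: "('n::finite, 'k::field) mpoly set \<Rightarrow> bool"
  where "graded_ideal I \<longleftrightarrow> ideal I polyring \<and> (\<forall>f\<in>I. \<forall>d. hom_component d f \<in> I)"

definition generated_in_single_degree :: "('n::finite, 'k::field) mpoly set \<Rightarrow> bool"
  where "generated_in_single_degree I \<longleftrightarrow>
    (\<exists>d. \<exists>G \<subseteq> graded_piece d. I = Idl\<^bsub>polyring\<^esub> G)"

definition monomial_ideal :: "('n::finite, 'k::field) mpoly set \<Rightarrow> bool"
  where "monomial_ideal I \<longleftrightarrow>
    (\<exists>M. I = Idl\<^bsub>polyring\<^esub> ((\<lambda>m. Poly_Mapping.single m 1) ` M))"

text \<open>Powers in the multiplicative monoid of ideals; the zeroth power is the unit ideal.\<close>

abbreviation ideal_power :: "('n, 'k::field) mpoly set \<Rightarrow> nat \<Rightarrow> ('n, 'k) mpoly set"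
  where "ideal_power I k \<equiv> I [^]\<^bsub>ideals_set polyring\<^esub> k"

definition colon :: "('n, 'k::field) mpoly set \<Rightarrow> ('n, 'k) mpoly \<Rightarrow> ('n, 'k) mpoly set"
  where "colon I f = {g. g * f \<in> I}"

text \<open>
  The associated primes of the module \<open>S/I\<close>: the annihilator of the class of \<open>f\<close> in \<open>S/I\<close>
  is \<open>(I : f)\<close>.  Here \<open>f\<close> is an arbitrary polynomial, not necessarily homogeneous.
\<close>

definition Ass :: "('n, 'k::field) mpoly set \<Rightarrow> ('n, 'k) mpoly set set"
  where "Ass I = {p. primeideal p polyring \<and> (\<exists>f. colon I f = p)}"

definition stable_primes :: "('n, 'k::field) mpoly set \<Rightarrow> ('n, 'k) mpoly set set"
  where "stable_primes I = {p. primeideal p polyring \<and> (\<forall>\<^sub>F k in sequentially. p \<in> Ass (ideal_power I k))}"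

definition initial_degree :: "('n::finite, 'k::field) mpoly set \<Rightarrow> nat"
  where "initial_degree I = (LEAST d. I \<inter> graded_piece d \<noteq> {0})"

definition v_local :: "('n::finite, 'k::field) mpoly set \<Rightarrow> ('n, 'k) mpoly set \<Rightarrow> nat"
  where "v_local p I = (LEAST d. \<exists>f\<in>graded_piece d. colon I f = p)"

definition v_number :: "('n::finite, 'k::field) mpoly set \<Rightarrow> nat"
  where "v_number I = (LEAST d. \<exists>f\<in>graded_piece d. colon I f \<in> Ass I)"

end

theory Submission
  imports Defs "HOL-Computational_Algebra.Primes"
begin

text \<open>
  Let \<open>I\<close> be generated by forms of degree \<open>\<alpha>\<close>, so that \<open>\<alpha>(I) = \<alpha>\<close>.  The proof compares
  \<open>I\<^sup>k\<close> with \<open>I\<^sup>k\<^sup>+\<^sup>1\<close>.  By Ratliff's theorem (lemma \<open>ideal_power_colon_eventually\<close>) one has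
  \<open>(I\<^sup>k\<^sup>+\<^sup>1 : I) = I\<^sup>k\<close> for all large \<open>k\<close>.  Suppose that \<open>(I\<^sup>k : f) = p\<close> is prime, with \<open>f\<close> homogeneous,
  and let \<open>G\<close> be a finite set of generators of degree \<open>\<alpha>\<close>.  Then
  \<open>p = ((I\<^sup>k\<^sup>+\<^sup>1 : I) : f) = \<Inter>\<^sub>g (I\<^sup>k\<^sup>+\<^sup>1 : f g)\<close>, where \<open>g\<close> runs over \<open>G\<close>.  A prime that is a finite
  intersection of ideals is one of them, so \<open>(I\<^sup>k\<^sup>+\<^sup>1 : f g) = p\<close> for some \<open>g \<in> G\<close> (lemma
  \<open>prime_colon_lift\<close>).  Hence, for large \<open>k\<close>, a witness of degree \<open>d\<close> for \<open>p\<close> at the exponent \<open>k\<close>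
  yields one of degree \<open>d + \<alpha>\<close> at the exponent \<open>k + 1\<close>, and both \<open>v\<^sub>p(I\<^sup>k) - \<alpha> k\<close> and
  \<open>v(I\<^sup>k) - \<alpha> k\<close> are eventually nonincreasing in \<open>k\<close>.

  They are also bounded below: if \<open>h \<in> p\<close> is a nonzero form of degree \<open>e\<close>, then \<open>h f\<close> is a nonzero
  element of \<open>I\<^sup>k\<close>, so \<open>deg f + e \<ge> \<alpha> k\<close> (lemma \<open>witness_degree_bound\<close>).  A nonzero generator \<open>h\<close> of \<open>I\<close>
  gives the bound \<open>-\<alpha>\<close>.  If \<open>I\<close> is a monomial ideal, then \<open>p\<close> contains a variable, and this gives
  the bound \<open>-1\<close>.  A nonincreasing sequence of integers that is bounded below is eventually
  constant, which proves the linearity.  A prime that attains \<open>v(I\<^sup>k)\<close> for one sufficiently large \<open>k\<close>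
  attains it for all larger exponents; in particular it is stable, and its constant is the minimum
  \<open>b\<close>.  Finiteness of the set of all associated primes of powers of \<open>I\<close> is not needed.

  Three classical ingredients are proved on the way.  The first is a leading-term argument with
  Dickson's lemma (lemma \<open>homogeneous_generators\<close>), from which both Hilbert's basis theorem and an
  Artin-Rees statement are derived.  The second is the derivation of Ratliff's theorem from the
  latter.  The third is the fact that an associated prime of a graded ideal is the annihilator of the
  class of a homogeneous element (lemma \<open>homogeneous_witness\<close>).
\<close>


section \<open>Ideals of a commutative ring\<close>

text \<open>
  The locale predicates of abstract algebra, read in the ring record of a type-class ring.
\<close>

lemma ideal_iff:
  "ideal J (ring_of_type_algebra :: 'a::comm_ring_1 ring) \<longleftrightarrow>
     0 \<in> J \<and> (\<forall>a\<in>J. \<forall>b\<in>J. a + b \<in> J) \<and> (\<forall>a\<in>J. \<forall>r. r * a \<in> J)"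
proof
  let ?R = "ring_of_type_algebra :: 'a ring"
  assume "ideal J ?R"
  then interpret ideal J ?R .
  show "0 \<in> J \<and> (\<forall>a\<in>J. \<forall>b\<in>J. a + b \<in> J) \<and> (\<forall>a\<in>J. \<forall>r. r * a \<in> J)"
    using additive_subgroup.zero_closed[OF is_additive_subgroup]
      additive_subgroup.a_closed[OF is_additive_subgroup] I_l_closed
    unfolding ring_of_type_algebra_def by simp
next
  let ?R = "ring_of_type_algebra :: 'a ring"
  assume J: "0 \<in> J \<and> (\<forall>a\<in>J. \<forall>b\<in>J. a + b \<in> J) \<and> (\<forall>a\<in>J. \<forall>r. r * a \<in> J)"
  interpret ring ?R by (rule ring_from_type_algebra)
  have neg: "- a \<in> J" if "a \<in> J" for a
    using J that by (metis mult_minus1)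
  show "ideal J ?R"
  proof (rule idealI)
    show "subgroup J (add_monoid ?R)"
    proof
      fix x assume x: "x \<in> J"
      have "\<ominus>\<^bsub>?R\<^esub> x = - x"
        by (rule minus_equality) (auto simp: ring_of_type_algebra_def)
      then show "inv\<^bsub>add_monoid ?R\<^esub> x \<in> J"
        using neg[OF x] by (simp add: a_inv_def)
    qed (use J in \<open>auto simp: ring_of_type_algebra_def\<close>)
  next
    fix a x assume "a \<in> J"
    then have "x * a \<in> J" "a * x \<in> J" using J by (simp, metis mult.commute)
    then show "x \<otimes>\<^bsub>?R\<^esub> a \<in> J" "a \<otimes>\<^bsub>?R\<^esub> x \<in> J"
      by (simp_all add: ring_of_type_algebra_def)
  qed (rule ring_from_type_algebra)
qed

lemma primeideal_iff:
  "primeideal p (ring_of_type_algebra :: 'a::comm_ring_1 ring) \<longleftrightarrow>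
     ideal p (ring_of_type_algebra :: 'a ring) \<and> p \<noteq> UNIV \<and> (\<forall>a b. a * b \<in> p \<longrightarrow> a \<in> p \<or> b \<in> p)"
proof -
  interpret cring "ring_of_type_algebra :: 'a ring" by (rule cring_from_type_algebra)
  show ?thesis
    unfolding primeideal_def primeideal_axioms_def
    by (auto simp: ring_of_type_algebra_def is_cring[unfolded ring_of_type_algebra_def])
qed

context
  fixes J :: "'a::comm_ring_1 set"
  assumes J: "ideal J ring_of_type_algebra"
begin

lemma ideal_zero: "0 \<in> J"
  using J by (simp add: ideal_iff)

lemma ideal_add: "a \<in> J \<Longrightarrow> b \<in> J \<Longrightarrow> a + b \<in> J"
  using J by (simp add: ideal_iff)

lemma ideal_mult_left: "a \<in> J \<Longrightarrow> r * a \<in> J"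
  using J by (simp add: ideal_iff)

lemma ideal_mult_right: "a \<in> J \<Longrightarrow> a * r \<in> J"
  using ideal_mult_left[of a r] by (simp add: mult.commute)

lemma ideal_diff: "a \<in> J \<Longrightarrow> b \<in> J \<Longrightarrow> a - b \<in> J"
  using ideal_add[of a "- 1 * b"] ideal_mult_left[of b "- 1"] by simp

lemma ideal_eq_UNIV: "1 \<in> J \<Longrightarrow> J = UNIV"
  using ideal_mult_left[of 1] by auto

end

lemma ideal_sum:
  assumes "ideal J (ring_of_type_algebra :: 'a::comm_ring_1 ring)" "\<And>x. x \<in> A \<Longrightarrow> f x \<in> J"
  shows "sum f A \<in> J"
  using assms(2) by (induction A rule: infinite_finite_induct)
    (auto simp: ideal_zero[OF assms(1)] ideal_add[OF assms(1)])

lemma prime_mult_mem: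
  assumes "primeideal p (ring_of_type_algebra :: 'a::comm_ring_1 ring)"
  shows "a * b \<in> p \<longleftrightarrow> a \<in> p \<or> b \<in> p"
  using assms by (auto simp: primeideal_iff ideal_mult_left ideal_mult_right)

lemma one_notin_prime:
  assumes "primeideal p (ring_of_type_algebra :: 'a::comm_ring_1 ring)"
  shows "1 \<notin> p"
  using assms ideal_eq_UNIV by (auto simp: primeideal_iff)

lemma prime_mem_of_power_mem:
  assumes "primeideal p (ring_of_type_algebra :: 'a::comm_ring_1 ring)" "a ^ k \<in> p"
  shows "a \<in> p"
  using assms(2) by (induction k) (auto simp: prime_mult_mem[OF assms(1)] one_notin_prime[OF assms(1)])

lemma genideal_ring_of_type_algebra:
  "Idl\<^bsub>ring_of_type_algebra :: 'a::comm_ring_1 ring\<^esub> G = \<Inter>{J. ideal J (ring_of_type_algebra :: 'a ring) \<and> G \<subseteq> J}"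
  by (rule genideal_def)

lemma ideal_genideal:
  "ideal (Idl\<^bsub>ring_of_type_algebra :: 'a::comm_ring_1 ring\<^esub> G) (ring_of_type_algebra :: 'a ring)"
  unfolding genideal_ring_of_type_algebra ideal_iff by auto

lemma genideal_superset: "G \<subseteq> Idl\<^bsub>ring_of_type_algebra :: 'a::comm_ring_1 ring\<^esub> G"
  unfolding genideal_ring_of_type_algebra by auto

lemma genideal_least:
  "ideal J (ring_of_type_algebra :: 'a::comm_ring_1 ring) \<Longrightarrow> G \<subseteq> J \<Longrightarrow>
    Idl\<^bsub>ring_of_type_algebra :: 'a ring\<^esub> G \<subseteq> J"
  unfolding genideal_ring_of_type_algebra by auto

text \<open>
  Membership in a generated ideal depends on finitely many generators: the elements with this
  property form an ideal that contains the generators.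
\<close>

lemma genideal_finite_subset:
  fixes G :: "'a::comm_ring_1 set"
  assumes "x \<in> Idl\<^bsub>ring_of_type_algebra\<^esub> G"
  shows "\<exists>G0\<subseteq>G. finite G0 \<and> x \<in> Idl\<^bsub>ring_of_type_algebra\<^esub> G0"
proof -
  define J where "J = {x :: 'a. \<exists>G0\<subseteq>G. finite G0 \<and> x \<in> Idl\<^bsub>ring_of_type_algebra\<^esub> G0}"
  have mono: "Idl\<^bsub>ring_of_type_algebra\<^esub> A \<subseteq> Idl\<^bsub>ring_of_type_algebra\<^esub> B" if "A \<subseteq> B" for A B :: "'a set"
    using that by (meson genideal_least genideal_superset ideal_genideal order_trans)
  have "ideal J ring_of_type_algebra"
    unfolding ideal_iff
  proof (intro conjI ballI allI)
    show "0 \<in> J" unfolding J_def using ideal_zero[OF ideal_genideal] by blast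
  next
    fix a b assume "a \<in> J" "b \<in> J"
    then obtain A B where "A \<subseteq> G" "finite A" "a \<in> Idl\<^bsub>ring_of_type_algebra\<^esub> A"
      "B \<subseteq> G" "finite B" "b \<in> Idl\<^bsub>ring_of_type_algebra\<^esub> B"
      unfolding J_def by auto
    then have "A \<union> B \<subseteq> G" "finite (A \<union> B)" "a + b \<in> Idl\<^bsub>ring_of_type_algebra\<^esub> (A \<union> B)"
      using mono[of A "A \<union> B"] mono[of B "A \<union> B"] ideal_add[OF ideal_genideal, of a "A \<union> B" b] by auto
    then show "a + b \<in> J" unfolding J_def by blast
  next
    fix a r assume "a \<in> J"
    then show "r * a \<in> J" unfolding J_def using ideal_mult_left[OF ideal_genideal] by blast
  qed
  moreover have "G \<subseteq> J"
  proof
    fix x assume "x \<in> G"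
    then show "x \<in> J" unfolding J_def using genideal_superset[of "{x}"]
      by (intro CollectI exI[of _ "{x}"]) auto
  qed
  ultimately have "Idl\<^bsub>ring_of_type_algebra\<^esub> G \<subseteq> J"
    by (rule genideal_least)
  then show ?thesis using assms unfolding J_def by auto
qed

lemma ideal_power_0: "ideal_power I 0 = UNIV"
  by (simp add: ideals_set_def nat_pow_def ring_of_type_algebra_def)

lemma ideal_power_Suc:
  "ideal_power I (Suc k) = ideal_prod polyring (ideal_power I k) I"
  by (simp add: ideals_set_def nat_pow_def)

lemma ideal_ideal_prod:
  assumes "ideal A (ring_of_type_algebra :: 'a::comm_ring_1 ring)" "ideal B (ring_of_type_algebra :: 'a ring)"
  shows "ideal (ideal_prod ring_of_type_algebra A B) (ring_of_type_algebra :: 'a ring)"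
  using ring.ideal_prod_is_ideal[OF ring_from_type_algebra assms] .

lemma ideal_prod_mem:
  assumes "a \<in> A" "b \<in> B"
  shows "a * b \<in> ideal_prod (ring_of_type_algebra :: 'a::comm_ring_1 ring) A B"
  using ideal_prod.prod[OF assms, of ring_of_type_algebra] by (simp add: ring_of_type_algebra_def)

lemma ideal_prod_subset:
  assumes "\<And>a b. a \<in> A \<Longrightarrow> b \<in> B \<Longrightarrow> a * b \<in> J" "\<And>x y. x \<in> J \<Longrightarrow> y \<in> J \<Longrightarrow> x + y \<in> J"
  shows "ideal_prod (ring_of_type_algebra :: 'a::comm_ring_1 ring) A B \<subseteq> J"
proof
  fix x assume "x \<in> ideal_prod (ring_of_type_algebra :: 'a ring) A B"
  then show "x \<in> J"
    by induction (use assms in \<open>auto simp: ring_of_type_algebra_def\<close>)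
qed

lemma ideal_UNIV: "ideal UNIV (ring_of_type_algebra :: 'a::comm_ring_1 ring)"
  by (simp add: ideal_iff)

lemma ideal_ideal_power:
  assumes "ideal I polyring"
  shows "ideal (ideal_power I k) polyring"
proof (induction k)
  case 0
  show ?case unfolding ideal_power_0 by (rule ideal_UNIV)
next
  case (Suc k)
  then show ?case unfolding ideal_power_Suc using assms by (rule ideal_ideal_prod)
qed

lemma ideal_power_decreasing:
  assumes "ideal I polyring"
  shows "ideal_power I (Suc k) \<subseteq> ideal_power I k"
  unfolding ideal_power_Suc
  by (rule ideal_prod_subset)
    (auto intro: ideal_mult_right ideal_add simp: ideal_ideal_power assms)

lemma ideal_power_subset:
  assumes "ideal I polyring" "k > 0"
  shows "ideal_power I k \<subseteq> I"
proof -
  obtain j where k: "k = Suc j" using assms(2) gr0_conv_Suc by auto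
  show ?thesis unfolding k ideal_power_Suc
    by (rule ideal_prod_subset) (auto intro: ideal_mult_left[OF assms(1)] ideal_add[OF assms(1)])
qed

lemma power_mem_ideal_power: "a \<in> I \<Longrightarrow> a ^ k \<in> ideal_power I k"
proof (induction k)
  case 0
  show ?case unfolding ideal_power_0 by simp
next
  case (Suc k)
  then show ?case
    unfolding ideal_power_Suc power_Suc2 by (intro ideal_prod_mem) auto
qed

lemma ideal_colon:
  assumes "ideal J polyring"
  shows "ideal (colon J f) polyring"
  using assms unfolding ideal_iff colon_def by (auto simp: distrib_right mult.assoc)

lemma subset_colon:
  assumes "ideal J polyring"
  shows "J \<subseteq> colon J f"
  using ideal_mult_right[OF assms] by (auto simp: colon_def)

section \<open>Dickson's lemma and leading monomials\<close>

lemma nondecreasing_subsequence: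
  fixes s :: "nat \<Rightarrow> nat"
  shows "\<exists>r. strict_mono r \<and> incseq (\<lambda>i. s (r i))"
proof -
  obtain f where f: "strict_mono f" "monoseq (\<lambda>n. s (f n))"
    using seq_monosub by blast
  show ?thesis
  proof (cases "incseq (\<lambda>n. s (f n))")
    case True
    then show ?thesis using f(1) by blast
  next
    case False
    then have dec: "\<And>m n. m \<le> n \<Longrightarrow> s (f n) \<le> s (f m)"
      using f(2) by (auto simp: monoseq_def incseq_def)
    \<comment> \<open>A nonincreasing sequence of naturals is constant from the index \<open>N\<close> of its minimum on.\<close>
    obtain N where N: "\<And>n. s (f N) \<le> s (f n)"
      using ex_has_least_nat[of "\<lambda>_. True" 0 "\<lambda>n. s (f n)"] by auto
    have "s (f (n + N)) = s (f N)" for n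
      using N dec[of N "n + N"] by (simp add: antisym)
    then have "incseq (\<lambda>i. s (f (i + N)))" by (simp add: incseq_def)
    moreover have "strict_mono (\<lambda>i. f (i + N))"
      using f(1) by (auto simp: strict_mono_def)
    ultimately show ?thesis by (intro exI[of _ "\<lambda>i. f (i + N)"]) simp
  qed
qed

lemma simultaneous_nondecreasing_subsequence:
  fixes s :: "nat \<Rightarrow> 'v \<Rightarrow> nat"
  assumes "finite V"
  shows "\<exists>r. strict_mono r \<and> (\<forall>v\<in>V. incseq (\<lambda>i. s (r i) v))"
  using assms
proof (induction V rule: finite_induct)
  case empty
  show ?case by (intro exI[of _ id]) (auto simp: strict_mono_def)
next
  case (insert v V)
  then obtain r where r: "strict_mono r" "\<And>w. w \<in> V \<Longrightarrow> incseq (\<lambda>i. s (r i) w)" by blast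
  obtain q where q: "strict_mono q" "incseq (\<lambda>i. s (r (q i)) v)"
    using nondecreasing_subsequence[of "\<lambda>i. s (r i) v"] by auto
  have "incseq (\<lambda>i. s (r (q i)) w)" if "w \<in> V" for w
    using r(2)[OF that] strict_mono_leD[OF q(1)] by (auto simp: incseq_def)
  moreover have "strict_mono (\<lambda>i. r (q i))"
    using r(1) q(1) by (auto simp: strict_mono_def)
  ultimately show ?case using q(2) by (intro exI[of _ "\<lambda>i. r (q i)"]) auto
qed

text \<open>
  Every set of exponent vectors in finitely many variables has a finite subset such that each of its
  vectors is at least one of the subset, componentwise.  The subset consists of the minimal
  vectors; an infinite set of these would contain two comparable ones.
\<close>

lemma dickson:
  fixes E :: "('v \<Rightarrow>\<^sub>0 nat) set"
  assumes V: "finite V" and E: "\<And>u. u \<in> E \<Longrightarrow> Poly_Mapping.keys u \<subseteq> V"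
  shows "\<exists>E0\<subseteq>E. finite E0 \<and> (\<forall>u\<in>E. \<exists>w\<in>E0. \<exists>d. Poly_Mapping.keys d \<subseteq> V \<and> u = w + d)"
proof -
  define le where "le w u \<longleftrightarrow> (\<forall>v. Poly_Mapping.lookup w v \<le> Poly_Mapping.lookup u v)"
    for w u :: "'v \<Rightarrow>\<^sub>0 nat"
  define E0 where "E0 = {u \<in> E. \<forall>w\<in>E. le w u \<longrightarrow> w = u}"
  have le_trans: "le u w" if "le u x" "le x w" for u x w
    using that unfolding le_def by (auto intro: order_trans)
  have above: "\<exists>w\<in>E0. le w u" if "u \<in> E" for u
    using that
  proof (induction "\<Sum>v\<in>V. Poly_Mapping.lookup u v" arbitrary: u rule: less_induct)
    case less
    show ?case
    proof (cases "u \<in> E0")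
      case True
      then show ?thesis by (auto simp: le_def)
    next
      case False
      then obtain w where w: "w \<in> E" "le w u" "w \<noteq> u"
        using less.prems unfolding E0_def by auto
      obtain v where v: "Poly_Mapping.lookup w v \<noteq> Poly_Mapping.lookup u v"
        using w(3) poly_mapping_eqI[of w u] by metis
      moreover have "Poly_Mapping.lookup w v \<le> Poly_Mapping.lookup u v"
        using w(2) unfolding le_def by blast
      ultimately have lt: "Poly_Mapping.lookup w v < Poly_Mapping.lookup u v" by simp
      then have "v \<in> V" using E[OF less.prems] by (auto simp: in_keys_iff)
      then have "(\<Sum>v\<in>V. Poly_Mapping.lookup w v) < (\<Sum>v\<in>V. Poly_Mapping.lookup u v)"
        using w(2) lt V unfolding le_def by (intro sum_strict_mono_ex1) auto
      then show ?thesis using less.hyps[OF _ w(1)] w(2) le_trans by blast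
    qed
  qed
  have "finite E0"
  proof (rule ccontr)
    assume "infinite E0"
    then obtain s :: "nat \<Rightarrow> 'v \<Rightarrow>\<^sub>0 nat" where s: "inj s" "range s \<subseteq> E0"
      using infinite_countable_subset by blast
    obtain r where r: "strict_mono r" "\<And>v. v \<in> V \<Longrightarrow> incseq (\<lambda>i. Poly_Mapping.lookup (s (r i)) v)"
      using simultaneous_nondecreasing_subsequence[OF V, of "\<lambda>i. Poly_Mapping.lookup (s i)"] by auto
    have "Poly_Mapping.lookup (s (r 0)) v \<le> Poly_Mapping.lookup (s (r 1)) v" for v
    proof (cases "v \<in> V")
      case True
      then show ?thesis using r(2)[OF True] by (simp add: incseq_def)
    next
      case False
      then have "v \<notin> Poly_Mapping.keys (s (r 0))"
        using E s(2) unfolding E0_def by blast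
      then show ?thesis by (simp add: in_keys_iff)
    qed
    then have "s (r 0) = s (r 1)"
      using s(2) unfolding E0_def le_def by blast
    then have "r 0 = r 1" using s(1) by (simp add: inj_eq)
    then show False using r(1) by (metis strict_mono_eq zero_neq_one)
  qed
  moreover have "\<exists>w\<in>E0. \<exists>d. Poly_Mapping.keys d \<subseteq> V \<and> u = w + d" if u: "u \<in> E" for u
  proof -
    obtain w where w: "w \<in> E0" "le w u" using above[OF u] by blast
    have "u = w + (u - w)"
      using w(2) by (intro poly_mapping_eqI) (simp add: lookup_add lookup_minus le_def)
    moreover have "Poly_Mapping.keys (u - w) \<subseteq> V"
      using E[OF u] by (auto simp: in_keys_iff lookup_minus)
    ultimately show ?thesis using w(1) by blast
  qed
  ultimately show ?thesis unfolding E0_def by (intro exI[of _ E0]) (auto simp: E0_def)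
qed

text \<open>
  A monomial order, as the order induced by a map \<open>g\<close> to the positive integers that turns sums of
  exponent vectors into products.  Distinct variables are sent to distinct primes, so that \<open>g\<close> is
  injective by unique factorization.  Well-foundedness and compatibility with addition are inherited
  from the natural numbers, and no linear order on the type of variables is needed.
\<close>

lemma monomial_order_exists:
  assumes V: "finite (V :: 'v set)"
  shows "\<exists>g :: ('v \<Rightarrow>\<^sub>0 nat) \<Rightarrow> nat. inj_on g {u. Poly_Mapping.keys u \<subseteq> V} \<and>
    (\<forall>u w. g (u + w) = g u * g w) \<and> (\<forall>u. g u > 0)"
proof -
  have inf: "infinite {p :: nat. prime p}" by (rule primes_infinite)
  obtain e :: "nat \<Rightarrow> nat" where e: "inj e" "range e \<subseteq> {p. prime p}"
    using infinite_countable_subset[OF inf] by blast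
  obtain i :: "'v \<Rightarrow> nat" where i: "inj_on i V"
    using finite_imp_inj_to_nat_seg[OF V] by blast
  define p where "p = (\<lambda>v. e (i v))"
  have p: "inj_on p V" "\<And>v. prime (p v)"
  proof -
    show "inj_on p V"
      using i injD[OF e(1)] unfolding p_def inj_on_def by blast
    show "prime (p v)" for v
      using subsetD[OF e(2), of "e (i v)"] unfolding p_def by simp
  qed
  define g where "g u = (\<Prod>v\<in>V. p v ^ Poly_Mapping.lookup u v)" for u
  have mult: "multiplicity (p v) (g u) = Poly_Mapping.lookup u v" if v: "v \<in> V" for u v
  proof -
    have "g u = (\<Prod>q\<in>p ` V. q ^ Poly_Mapping.lookup u (inv_into V p q))"
      unfolding g_def using p(1) by (subst prod.reindex) auto
    also have "multiplicity (p v) \<dots> = Poly_Mapping.lookup u v"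
      using p v V by (subst multiplicity_prod_prime_powers) auto
    finally show ?thesis .
  qed
  have "inj_on g {u. Poly_Mapping.keys u \<subseteq> V}"
  proof (rule inj_onI)
    fix u w assume u: "u \<in> {u. Poly_Mapping.keys u \<subseteq> V}" and w: "w \<in> {u. Poly_Mapping.keys u \<subseteq> V}"
      and eq: "g u = g w"
    show "u = w"
    proof (rule poly_mapping_eqI)
      fix v
      show "Poly_Mapping.lookup u v = Poly_Mapping.lookup w v"
      proof (cases "v \<in> V")
        case True
        then show ?thesis using mult[OF True, of u] mult[OF True, of w] eq by simp
      next
        case False
        then have "v \<notin> Poly_Mapping.keys u" "v \<notin> Poly_Mapping.keys w" using u w by auto
        then show ?thesis by (simp add: in_keys_iff)
      qed
    qed
  qed
  moreover have "g (u + w) = g u * g w" for u w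
    unfolding g_def by (simp add: lookup_add power_add prod.distrib)
  moreover have "g u > 0" for u
    unfolding g_def using p(2) by (auto intro!: prod_pos simp: prime_gt_0_nat)
  ultimately show ?thesis by blast
qed

lemma lookup_single_mult:
  fixes G :: "('v \<Rightarrow>\<^sub>0 nat) \<Rightarrow>\<^sub>0 'k::semiring_0"
  shows "Poly_Mapping.lookup (Poly_Mapping.single d c * G) (w + d) = c * Poly_Mapping.lookup G w"
proof -
  have "Poly_Mapping.lookup (Poly_Mapping.single d c * G) (d + w) = c * Poly_Mapping.lookup G w"
    by (simp add: lookup_mult lookup_single when_mult Sum_any_when_equal')
  then show ?thesis by (simp add: add.commute)
qed

lemma leading_monomial_exists:
  fixes g :: "('v \<Rightarrow>\<^sub>0 nat) \<Rightarrow> nat" and F :: "('v \<Rightarrow>\<^sub>0 nat) \<Rightarrow>\<^sub>0 'k::zero"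
  assumes "F \<noteq> 0"
  shows "\<exists>u\<in>Poly_Mapping.keys F. \<forall>w\<in>Poly_Mapping.keys F. g w \<le> g u"
proof -
  have ne: "Poly_Mapping.keys F \<noteq> {}" and fin: "finite (Poly_Mapping.keys F)"
    using assms by auto
  then have "Max (g ` Poly_Mapping.keys F) \<in> g ` Poly_Mapping.keys F" by simp
  then obtain u where "u \<in> Poly_Mapping.keys F" "g u = Max (g ` Poly_Mapping.keys F)" by auto
  then show ?thesis using fin by (intro bexI[of _ u]) auto
qed

lemma keys_single_mult:
  fixes G :: "('v \<Rightarrow>\<^sub>0 nat) \<Rightarrow>\<^sub>0 'k::semiring_0"
  assumes "x \<in> Poly_Mapping.keys (Poly_Mapping.single d c * G)"
  shows "\<exists>w\<in>Poly_Mapping.keys G. x = w + d"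
proof -
  obtain a b where "x = a + b" "a \<in> Poly_Mapping.keys (Poly_Mapping.single d c)" "b \<in> Poly_Mapping.keys G"
    using assms keys_mult[of "Poly_Mapping.single d c" G] by blast
  then show ?thesis by (auto simp: add.commute split: if_splits)
qed

text \<open>
  The common core of Hilbert's basis theorem and of the Artin-Rees lemma.  Let \<open>M k\<close> be additive
  groups of polynomials that are homogeneous of degree \<open>k\<close> for an additive weight \<open>\<delta>\<close> (possibly
  zero), such that multiplication by a term of weight \<open>e\<close> maps \<open>M k\<close> into \<open>M (k + e)\<close>.  Then there is
  a finite set \<open>B\<close> of elements of the \<open>M j\<close>, each paired with its index \<open>j\<close>, such that every element
  of \<open>M k\<close> is a sum of products of elements of \<open>B\<close> with terms that land in degree exactly \<open>k\<close>.
  Being such a sum is expressed as membership in every additively closed set \<open>Q\<close> that contains \<open>0\<close>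
  and these products.  By Dickson's lemma finitely many leading exponents divide all others, and
  \<open>B\<close> consists of one polynomial for each of them; division with remainder ends in \<open>0\<close>.
\<close>

lemma homogeneous_generators:
  fixes M :: "nat \<Rightarrow> (('v \<Rightarrow>\<^sub>0 nat) \<Rightarrow>\<^sub>0 'k::field) set" and \<delta> :: "('v \<Rightarrow>\<^sub>0 nat) \<Rightarrow> nat"
  assumes V: "finite V"
    and keys_M: "\<And>k F u. F \<in> M k \<Longrightarrow> u \<in> Poly_Mapping.keys F \<Longrightarrow> Poly_Mapping.keys u \<subseteq> V \<and> \<delta> u = k"
    and \<delta>: "\<And>u w. \<delta> (u + w) = \<delta> u + \<delta> w"
    and diff: "\<And>k F G. F \<in> M k \<Longrightarrow> G \<in> M k \<Longrightarrow> F - G \<in> M k"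
    and shift: "\<And>k F u c. F \<in> M k \<Longrightarrow> Poly_Mapping.keys u \<subseteq> V \<Longrightarrow> Poly_Mapping.single u c * F \<in> M (k + \<delta> u)"
  shows "\<exists>B. finite B \<and> (\<forall>(j, G)\<in>B. G \<in> M j) \<and>
    (\<forall>k F Q. F \<in> M k \<longrightarrow> 0 \<in> Q \<longrightarrow> (\<forall>F\<in>Q. \<forall>G\<in>Q. F + G \<in> Q) \<longrightarrow>
      (\<forall>(j, G)\<in>B. \<forall>u c. Poly_Mapping.keys u \<subseteq> V \<longrightarrow> j + \<delta> u = k \<longrightarrow> Poly_Mapping.single u c * G \<in> Q) \<longrightarrow> F \<in> Q)"
proof -
  obtain g :: "('v \<Rightarrow>\<^sub>0 nat) \<Rightarrow> nat" where g: "inj_on g {u. Poly_Mapping.keys u \<subseteq> V}"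
    "\<And>u w. g (u + w) = g u * g w" "\<And>u. g u > 0"
    using monomial_order_exists[OF V] by blast
  define lead where "lead F u \<longleftrightarrow> u \<in> Poly_Mapping.keys F \<and> (\<forall>w\<in>Poly_Mapping.keys F. g w \<le> g u)"
    for F :: "('v \<Rightarrow>\<^sub>0 nat) \<Rightarrow>\<^sub>0 'k" and u
  define E where "E = {u. \<exists>k. \<exists>F\<in>M k. lead F u}"
  have E: "Poly_Mapping.keys u \<subseteq> V" if "u \<in> E" for u
    using that keys_M unfolding E_def lead_def by blast
  obtain E0 where E0: "E0 \<subseteq> E" "finite E0"
    "\<And>u. u \<in> E \<Longrightarrow> \<exists>w\<in>E0. \<exists>d. Poly_Mapping.keys d \<subseteq> V \<and> u = w + d"
    using dickson[OF V, of E] E by blast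
  have "\<forall>w\<in>E0. \<exists>G. G \<in> M (\<delta> w) \<and> lead G w"
  proof
    fix w assume "w \<in> E0"
    then obtain k G where "G \<in> M k" "lead G w" using E0(1) unfolding E_def by blast
    moreover from this have "\<delta> w = k" using keys_M unfolding lead_def by blast
    ultimately show "\<exists>G. G \<in> M (\<delta> w) \<and> lead G w" by blast
  qed
  then obtain b where b: "\<And>w. w \<in> E0 \<Longrightarrow> b w \<in> M (\<delta> w) \<and> lead (b w) w" by metis
  define B where "B = (\<lambda>w. (\<delta> w, b w)) ` E0"
  have main: "F \<in> Q" if Q0: "0 \<in> Q" and Qadd: "\<And>F G. F \<in> Q \<Longrightarrow> G \<in> Q \<Longrightarrow> F + G \<in> Q"
    and Q: "\<And>w u c. w \<in> E0 \<Longrightarrow> Poly_Mapping.keys u \<subseteq> V \<Longrightarrow> \<delta> w + \<delta> u = k \<Longrightarrow> Poly_Mapping.single u c * b w \<in> Q"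
    and F: "F \<in> M k" "\<forall>u\<in>Poly_Mapping.keys F. g u < N" for N F k Q
    using F
  proof (induction N arbitrary: F rule: less_induct)
    case (less N F)
    show ?case
    proof (cases "F = 0")
      case True
      then show ?thesis using Q0 by simp
    next
      case False
      then obtain u where u: "lead F u" using leading_monomial_exists[of F g] unfolding lead_def by blast
      then have uF: "u \<in> Poly_Mapping.keys F" by (simp add: lead_def)
      have "u \<in> E" using u less.prems(1) unfolding E_def by blast
      then obtain w d where w: "w \<in> E0" and d: "Poly_Mapping.keys d \<subseteq> V" "u = w + d"
        using E0(3) by blast
      have lb: "lead (b w) w" and bM: "b w \<in> M (\<delta> w)" using b[OF w] by auto
      have cb: "Poly_Mapping.lookup (b w) w \<noteq> 0" using lb by (simp add: lead_def in_keys_iff)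
      have k: "\<delta> w + \<delta> d = k" using keys_M[OF less.prems(1) uF] d \<delta> by simp
      \<comment> \<open>The multiple of the basis element that cancels the leading term of \<open>F\<close>.\<close>
      define c where "c = Poly_Mapping.lookup F u / Poly_Mapping.lookup (b w) w"
      define H where "H = Poly_Mapping.single d c * b w"
      have HQ: "H \<in> Q" unfolding H_def by (rule Q[OF w d(1) k])
      have HM: "H \<in> M k" unfolding H_def using shift[OF bM d(1)] k by simp
      have "F - H \<in> M k" by (rule diff[OF less.prems(1) HM])
      moreover have "\<forall>x\<in>Poly_Mapping.keys (F - H). g x < g u"
      proof
        fix x assume x: "x \<in> Poly_Mapping.keys (F - H)"
        then have "x \<in> Poly_Mapping.keys F \<or> x \<in> Poly_Mapping.keys H"
          by (auto simp: in_keys_iff lookup_minus)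
        then have "g x \<le> g u"
        proof
          assume "x \<in> Poly_Mapping.keys F"
          then show ?thesis using u by (simp add: lead_def)
        next
          assume "x \<in> Poly_Mapping.keys H"
          then obtain y where y: "y \<in> Poly_Mapping.keys (b w)" "x = y + d"
            unfolding H_def using keys_single_mult by blast
          then show ?thesis using lb d(2) g(2) by (simp add: lead_def)
        qed
        moreover have "Poly_Mapping.lookup (F - H) u = 0"
          unfolding H_def d(2) lookup_minus lookup_single_mult
          using cb by (simp add: c_def d(2))
        then have "x \<noteq> u" using x by (auto simp: in_keys_iff)
        then have "g x \<noteq> g u"
          using g(1) keys_M[OF \<open>F - H \<in> M k\<close> x] keys_M[OF less.prems(1) uF]
          by (auto dest: inj_onD)
        ultimately show "g x < g u" by simp
      qed
      moreover have "g u < N" using less.prems(2) uF by blast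
      ultimately have "F - H \<in> Q" using less.IH by blast
      then show ?thesis using Qadd[OF _ HQ, of "F - H"] by simp
    qed
  qed
  show ?thesis
  proof (intro exI[of _ B] conjI allI impI)
    show "finite B" unfolding B_def using E0(2) by simp
    show "\<forall>(j, G)\<in>B. G \<in> M j" unfolding B_def using b by auto
  next
    fix k F Q
    assume F: "F \<in> M k" and Q: "0 \<in> Q" "\<forall>F\<in>Q. \<forall>G\<in>Q. F + G \<in> Q"
      "\<forall>(j, G)\<in>B. \<forall>u c. Poly_Mapping.keys u \<subseteq> V \<longrightarrow> j + \<delta> u = k \<longrightarrow> Poly_Mapping.single u c * G \<in> Q"
    obtain N where "\<forall>u\<in>Poly_Mapping.keys F. g u < N"
      using finite_nat_set_iff_bounded[of "g ` Poly_Mapping.keys F"] by auto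
    then show "F \<in> Q"
      using Q by (intro main[where F = F and k = k and N = N and Q = Q] F) (auto simp: B_def)
  qed
qed

section \<open>The polynomial ring is a Noetherian domain\<close>

text \<open>
  The product of the leading terms of \<open>F\<close> and \<open>G\<close> cannot be cancelled by the remaining terms.
\<close>

lemma mpoly_no_zero_divisors:
  fixes F G :: "('n::finite, 'k::field) mpoly"
  assumes "F * G = 0"
  shows "F = 0 \<or> G = 0"
proof (rule ccontr)
  assume "\<not> ?thesis"
  then have ne: "F \<noteq> 0" "G \<noteq> 0" by auto
  obtain g :: "('n \<Rightarrow>\<^sub>0 nat) \<Rightarrow> nat" where g: "inj_on g UNIV"
    "\<And>u w. g (u + w) = g u * g w" "\<And>u. g u > 0"
    using monomial_order_exists[of "UNIV :: 'n set"] by auto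
  obtain u where u: "u \<in> Poly_Mapping.keys F" "\<And>x. x \<in> Poly_Mapping.keys F \<Longrightarrow> g x \<le> g u"
    using leading_monomial_exists[OF ne(1), of g] by blast
  obtain w where w: "w \<in> Poly_Mapping.keys G" "\<And>x. x \<in> Poly_Mapping.keys G \<Longrightarrow> g x \<le> g w"
    using leading_monomial_exists[OF ne(2), of g] by blast
  define F' where "F' = F - Poly_Mapping.single u (Poly_Mapping.lookup F u)"
  have F': "x \<in> Poly_Mapping.keys F" "x \<noteq> u" if "x \<in> Poly_Mapping.keys F'" for x
    using that unfolding F'_def by (auto simp: in_keys_iff lookup_minus lookup_single when_def split: if_splits)
  have "Poly_Mapping.lookup (F' * G) (w + u) = 0"
  proof (rule ccontr)
    assume "Poly_Mapping.lookup (F' * G) (w + u) \<noteq> 0"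
    then have "w + u \<in> Poly_Mapping.keys (F' * G)" by (simp add: in_keys_iff)
    then obtain x y where xy: "w + u = x + y" "x \<in> Poly_Mapping.keys F'" "y \<in> Poly_Mapping.keys G"
      using keys_mult[of F' G] by blast
    have "g x \<le> g u" "x \<noteq> u" "g y \<le> g w" using F'[OF xy(2)] u(2) w(2)[OF xy(3)] by auto
    moreover have "g x \<noteq> g u" using g(1) \<open>x \<noteq> u\<close> by (auto dest: injD)
    ultimately have "g x * g y < g u * g w"
      using g(3)[of w] g(3)[of y] by (intro mult_less_le_imp_less) auto
    moreover have "g x * g y = g u * g w" using g(2) xy(1) by (metis mult.commute)
    ultimately show False by simp
  qed
  moreover have "F * G = Poly_Mapping.single u (Poly_Mapping.lookup F u) * G + F' * G"
    unfolding F'_def by (simp add: algebra_simps)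
  ultimately have "Poly_Mapping.lookup (F * G) (w + u) = Poly_Mapping.lookup F u * Poly_Mapping.lookup G w"
    by (simp add: lookup_add lookup_single_mult)
  then show False using assms u(1) w(1) by (simp add: in_keys_iff)
qed

text \<open>
  Hilbert's basis theorem: the case of the zero weight, with a given ideal in degree \<open>0\<close> and nothing
  in the other degrees.
\<close>

lemma ideal_finitely_generated:
  fixes J :: "('n::finite, 'k::field) mpoly set"
  assumes J: "ideal J polyring"
  shows "\<exists>B\<subseteq>J. finite B \<and> J = Idl\<^bsub>polyring\<^esub> B"
proof -
  define M where "M k = (if k = 0 then J else {})" for k :: nat
  have "finite (UNIV :: 'n set)" by simp
  then have "\<exists>B. finite B \<and> (\<forall>(j, G)\<in>B. G \<in> M j) \<and>
    (\<forall>k F Q. F \<in> M k \<longrightarrow> 0 \<in> Q \<longrightarrow> (\<forall>F\<in>Q. \<forall>G\<in>Q. F + G \<in> Q) \<longrightarrow>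
      (\<forall>(j, G)\<in>B. \<forall>u c. Poly_Mapping.keys u \<subseteq> UNIV \<longrightarrow> j + 0 = k \<longrightarrow>
        Poly_Mapping.single u c * G \<in> Q) \<longrightarrow> F \<in> Q)"
  proof (rule homogeneous_generators[where M = M and \<delta> = "\<lambda>_. 0"])
    show "F - G \<in> M k" if "F \<in> M k" "G \<in> M k" for k F G
      using that ideal_diff[OF J] by (auto simp: M_def split: if_splits)
    show "Poly_Mapping.single u c * F \<in> M (k + 0)" if "F \<in> M k" for k F u c
      using that ideal_mult_left[OF J] by (auto simp: M_def split: if_splits)
    show "Poly_Mapping.keys u \<subseteq> UNIV \<and> 0 = k" if "F \<in> M k" for k F and u :: "'n \<Rightarrow>\<^sub>0 nat"
      using that by (simp add: M_def split: if_splits)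
  qed simp
  then obtain B :: "(nat \<times> ('n, 'k) mpoly) set" where B: "finite B" "\<forall>(j, G)\<in>B. G \<in> M j"
    and gen: "\<forall>k F Q. F \<in> M k \<longrightarrow> 0 \<in> Q \<longrightarrow> (\<forall>F\<in>Q. \<forall>G\<in>Q. F + G \<in> Q) \<longrightarrow>
      (\<forall>(j, G)\<in>B. \<forall>u c. Poly_Mapping.keys u \<subseteq> UNIV \<longrightarrow> j + 0 = k \<longrightarrow>
        Poly_Mapping.single u c * G \<in> Q) \<longrightarrow> F \<in> Q"
    by (elim exE conjE)
  have sub: "snd ` B \<subseteq> J" using B(2) by (auto simp: M_def split: if_splits)
  have "J \<subseteq> Idl\<^bsub>polyring\<^esub> (snd ` B)"
  proof
    fix F assume "F \<in> J"
    then have F: "F \<in> M 0" by (simp add: M_def)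
    show "F \<in> Idl\<^bsub>polyring\<^esub> (snd ` B)"
    proof (rule gen[THEN spec, THEN spec, THEN spec, THEN mp, OF F, THEN mp, THEN mp, THEN mp])
      show "0 \<in> Idl\<^bsub>polyring\<^esub> (snd ` B)" by (rule ideal_zero[OF ideal_genideal])
      show "\<forall>F\<in>Idl\<^bsub>polyring\<^esub> (snd ` B). \<forall>G\<in>Idl\<^bsub>polyring\<^esub> (snd ` B). F + G \<in> Idl\<^bsub>polyring\<^esub> (snd ` B)"
        by (intro ballI ideal_add[OF ideal_genideal])
      have "snd x \<in> Idl\<^bsub>polyring\<^esub> (snd ` B)" if "x \<in> B" for x
        using that genideal_superset by blast
      then show "\<forall>(j, G)\<in>B. \<forall>u c. Poly_Mapping.keys u \<subseteq> UNIV \<longrightarrow> j + 0 = 0 \<longrightarrow>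
          Poly_Mapping.single u c * G \<in> Idl\<^bsub>polyring\<^esub> (snd ` B)"
        by (auto intro!: ideal_mult_left[OF ideal_genideal])
    qed
  qed
  then show ?thesis using sub B(1) genideal_least[OF J sub] by blast
qed

lemma finite_generating_subset:
  fixes G :: "('n::finite, 'k::field) mpoly set"
  shows "\<exists>G0\<subseteq>G. finite G0 \<and> Idl\<^bsub>polyring\<^esub> G = Idl\<^bsub>polyring\<^esub> G0"
proof -
  obtain B where B: "B \<subseteq> Idl\<^bsub>polyring\<^esub> G" "finite B" "Idl\<^bsub>polyring\<^esub> G = Idl\<^bsub>polyring\<^esub> B"
    using ideal_finitely_generated[OF ideal_genideal, of G] by blast
  have "\<forall>b\<in>B. \<exists>A\<subseteq>G. finite A \<and> b \<in> Idl\<^bsub>polyring\<^esub> A"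
    using B(1) genideal_finite_subset by blast
  then obtain A where A: "\<And>b. b \<in> B \<Longrightarrow> A b \<subseteq> G \<and> finite (A b) \<and> b \<in> Idl\<^bsub>polyring\<^esub> (A b)"
    by metis
  let ?G0 = "\<Union>b\<in>B. A b"
  have "B \<subseteq> Idl\<^bsub>polyring\<^esub> ?G0"
  proof
    fix b assume b: "b \<in> B"
    have "Idl\<^bsub>polyring\<^esub> (A b) \<subseteq> Idl\<^bsub>polyring\<^esub> ?G0"
      using b genideal_superset[of ?G0] by (intro genideal_least[OF ideal_genideal]) blast
    then show "b \<in> Idl\<^bsub>polyring\<^esub> ?G0" using A[OF b] by blast
  qed
  then have "Idl\<^bsub>polyring\<^esub> G \<subseteq> Idl\<^bsub>polyring\<^esub> ?G0"
    unfolding B(3) by (rule genideal_least[OF ideal_genideal])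
  moreover have "?G0 \<subseteq> G" using A by blast
  moreover from this have "Idl\<^bsub>polyring\<^esub> ?G0 \<subseteq> Idl\<^bsub>polyring\<^esub> G"
    using genideal_superset[of G] by (intro genideal_least[OF ideal_genideal]) blast
  moreover have "finite ?G0" using A B(2) by blast
  ultimately show ?thesis by (intro exI[of _ ?G0]) auto
qed

lemma family_of_ideals_has_maximal:
  fixes \<A> :: "('n::finite, 'k::field) mpoly set set"
  assumes "\<A> \<noteq> {}" "\<And>J. J \<in> \<A> \<Longrightarrow> ideal J polyring"
  shows "\<exists>P\<in>\<A>. \<forall>J\<in>\<A>. P \<subseteq> J \<longrightarrow> J = P"
proof (rule subset_Zorn_nonempty[OF assms(1)])
  fix C assume C: "C \<noteq> {}" and chain: "subset.chain \<A> C"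
  have CA: "C \<subseteq> \<A>" and total: "\<forall>S\<in>C. \<forall>T\<in>C. S \<subseteq> T \<or> T \<subseteq> S"
    using chain unfolding subset_chain_def by auto
  have id: "\<And>S. S \<in> C \<Longrightarrow> ideal S polyring" using CA assms(2) by blast
  have "ideal (\<Union>C) polyring"
    unfolding ideal_iff
  proof (intro conjI ballI allI)
    show "0 \<in> \<Union>C" using C id ideal_zero by blast
  next
    fix a b assume "a \<in> \<Union>C" "b \<in> \<Union>C"
    then obtain S T where "S \<in> C" "a \<in> S" "T \<in> C" "b \<in> T" by blast
    then obtain U where "U \<in> C" "a \<in> U" "b \<in> U" using total by blast
    then show "a + b \<in> \<Union>C" using ideal_add[OF id[OF \<open>U \<in> C\<close>]] by blast
  next
    fix a r assume "a \<in> \<Union>C"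
    then obtain S where "S \<in> C" "a \<in> S" by blast
    then show "r * a \<in> \<Union>C" using ideal_mult_left[OF id[OF \<open>S \<in> C\<close>]] by blast
  qed
  then obtain B where B: "B \<subseteq> \<Union>C" "finite B" "\<Union>C = Idl\<^bsub>polyring\<^esub> B"
    using ideal_finitely_generated[of "\<Union>C"] by metis
  obtain S where S: "S \<in> C" "B \<subseteq> S"
    using finite_subset_Union_chain[OF B(2,1) C chain] by blast
  then have "\<Union>C \<subseteq> S" unfolding B(3) using id by (intro genideal_least) auto
  then have "\<Union>C = S" using S(1) by blast
  then show "\<Union>C \<in> \<A>" using S(1) CA by blast
qed

section \<open>Evaluation of polynomials and the Rees algebra\<close>

lemma exponent_split:
  fixes u :: "'v \<Rightarrow>\<^sub>0 nat"
  assumes "v \<in> Poly_Mapping.keys u"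
  shows "u = Poly_Mapping.single v 1 + (u - Poly_Mapping.single v 1)"
  using assms
  by (intro poly_mapping_eqI) (auto simp: lookup_add lookup_minus lookup_single when_def in_keys_iff)

lemma exponent_induct [consumes 1, case_names zero step]:
  fixes u :: "'v \<Rightarrow>\<^sub>0 nat"
  assumes "Poly_Mapping.keys u \<subseteq> V" and "P 0"
    and "\<And>v u. v \<in> V \<Longrightarrow> Poly_Mapping.keys u \<subseteq> V \<Longrightarrow> P u \<Longrightarrow> P (Poly_Mapping.single v 1 + u)"
  shows "P u"
  using assms(1)
proof (induction "\<Sum>v\<in>Poly_Mapping.keys u. Poly_Mapping.lookup u v" arbitrary: u rule: less_induct)
  case less
  show ?case
  proof (cases "u = 0")
    case True
    then show ?thesis using assms(2) by simp
  next
    case False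
    then obtain v where v: "v \<in> Poly_Mapping.keys u" by fastforce
    define w where "w = u - Poly_Mapping.single v 1"
    have u: "u = Poly_Mapping.single v 1 + w" unfolding w_def by (rule exponent_split[OF v])
    have sub: "Poly_Mapping.keys w \<subseteq> Poly_Mapping.keys u"
      unfolding w_def by (auto simp: in_keys_iff lookup_minus)
    have "(\<Sum>v\<in>Poly_Mapping.keys w. Poly_Mapping.lookup w v) = (\<Sum>v\<in>Poly_Mapping.keys u. Poly_Mapping.lookup w v)"
      using sub by (intro sum.mono_neutral_left) (auto simp: in_keys_iff)
    also have "\<dots> < (\<Sum>v\<in>Poly_Mapping.keys u. Poly_Mapping.lookup u v)"
    proof (rule sum_strict_mono_ex1)
      show "\<forall>x\<in>Poly_Mapping.keys u. Poly_Mapping.lookup w x \<le> Poly_Mapping.lookup u x"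
        unfolding w_def by (simp add: lookup_minus)
      show "\<exists>x\<in>Poly_Mapping.keys u. Poly_Mapping.lookup w x < Poly_Mapping.lookup u x"
        using v unfolding w_def
        by (intro bexI[of _ v]) (auto simp: lookup_minus lookup_single in_keys_iff)
    qed simp
    finally have "P w" using less sub by blast
    then show ?thesis using assms(3)[of v w] v sub less.prems u by auto
  qed
qed

lemma sum_monomials:
  fixes F :: "'v \<Rightarrow>\<^sub>0 'k::comm_monoid_add"
  shows "(\<Sum>m\<in>Poly_Mapping.keys F. Poly_Mapping.single m (Poly_Mapping.lookup F m)) = F"
proof (rule poly_mapping_eqI)
  fix x
  have "(\<Sum>m\<in>Poly_Mapping.keys F. Poly_Mapping.lookup F m when m = x) =
    (\<Sum>m\<in>Poly_Mapping.keys F. if x = m then Poly_Mapping.lookup F m else 0)"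
    by (intro sum.cong) (auto simp: when_def)
  then show "Poly_Mapping.lookup (\<Sum>m\<in>Poly_Mapping.keys F. Poly_Mapping.single m (Poly_Mapping.lookup F m)) x
    = Poly_Mapping.lookup F x"
    by (simp add: lookup_sum lookup_single in_keys_iff)
qed

text \<open>
  The value of a monomial at the point \<open>h\<close>.  Only the variables in \<open>V\<close> are evaluated: all monomials in
  use involve variables of a finite set \<open>V\<close> only, although the type of variables may be infinite.
\<close>

definition mon_eval :: "'v set \<Rightarrow> ('v \<Rightarrow> ('n, 'k::field) mpoly) \<Rightarrow> ('v \<Rightarrow>\<^sub>0 nat) \<Rightarrow> ('n, 'k) mpoly"
  where "mon_eval V h u = (\<Prod>v\<in>V. h v ^ Poly_Mapping.lookup u v)"

text \<open>Evaluation at \<open>h\<close>, with scalars mapped to constant polynomials.\<close>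

definition poly_eval :: "'v set \<Rightarrow> ('v \<Rightarrow> ('n, 'k::field) mpoly) \<Rightarrow> ('v, 'k) mpoly \<Rightarrow> ('n, 'k) mpoly"
  where "poly_eval V h F =
    (\<Sum>u\<in>Poly_Mapping.keys F. Poly_Mapping.single 0 (Poly_Mapping.lookup F u) * mon_eval V h u)"

lemma mon_eval_0 [simp]: "mon_eval V h 0 = 1"
  by (simp add: mon_eval_def)

lemma mon_eval_add: "mon_eval V h (u + w) = mon_eval V h u * mon_eval V h w"
  by (simp add: mon_eval_def lookup_add power_add prod.distrib)

lemma mon_eval_single:
  assumes "finite V" "v \<in> V"
  shows "mon_eval V h (Poly_Mapping.single v 1) = h v"
proof -
  have "mon_eval V h (Poly_Mapping.single v 1) = (\<Prod>w\<in>V. if v = w then h w else 1)"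
    unfolding mon_eval_def by (intro prod.cong) (auto simp: lookup_single)
  then show ?thesis using assms by simp
qed

lemma poly_eval_superset:
  assumes "finite A" "Poly_Mapping.keys F \<subseteq> A"
  shows "poly_eval V h F = (\<Sum>u\<in>A. Poly_Mapping.single 0 (Poly_Mapping.lookup F u) * mon_eval V h u)"
  unfolding poly_eval_def using assms by (intro sum.mono_neutral_left) (auto simp: in_keys_iff)

lemma poly_eval_0 [simp]: "poly_eval V h 0 = 0"
  by (simp add: poly_eval_def)

lemma poly_eval_add: "poly_eval V h (F + G) = poly_eval V h F + poly_eval V h G"
proof -
  let ?A = "Poly_Mapping.keys F \<union> Poly_Mapping.keys G"
  have "Poly_Mapping.keys (F + G) \<subseteq> ?A" by (rule keys_add)
  then show ?thesis
    by (simp add: poly_eval_superset[of ?A] lookup_add single_add distrib_right sum.distrib)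
qed

lemma poly_eval_diff: "poly_eval V h (F - G) = poly_eval V h F - poly_eval V h G"
  using poly_eval_add[of V h "F - G" G] by simp

lemma poly_eval_shift:
  fixes h :: "'v \<Rightarrow> ('n, 'k::field) mpoly"
  shows "poly_eval V h (Poly_Mapping.single d c * F) = Poly_Mapping.single 0 c * mon_eval V h d * poly_eval V h F"
proof -
  let ?A = "(\<lambda>w. w + d) ` Poly_Mapping.keys F"
  have "Poly_Mapping.keys (Poly_Mapping.single d c * F) \<subseteq> ?A"
    using keys_single_mult by blast
  then have "poly_eval V h (Poly_Mapping.single d c * F) =
    (\<Sum>u\<in>?A. Poly_Mapping.single 0 (Poly_Mapping.lookup (Poly_Mapping.single d c * F) u) * mon_eval V h u)"
    by (intro poly_eval_superset) auto
  also have "\<dots> = (\<Sum>w\<in>Poly_Mapping.keys F.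
      Poly_Mapping.single 0 (c * Poly_Mapping.lookup F w) * mon_eval V h (w + d))"
    by (subst sum.reindex) (auto simp: inj_on_def lookup_single_mult)
  also have "\<dots> = (\<Sum>w\<in>Poly_Mapping.keys F. Poly_Mapping.single 0 c * mon_eval V h d *
      (Poly_Mapping.single 0 (Poly_Mapping.lookup F w) * mon_eval V h w))"
  proof (rule sum.cong[OF refl])
    fix w
    have "Poly_Mapping.single 0 (c * Poly_Mapping.lookup F w) =
      Poly_Mapping.single 0 c * (Poly_Mapping.single 0 (Poly_Mapping.lookup F w) :: ('n, 'k) mpoly)"
      by (simp add: mult_single)
    then show "Poly_Mapping.single 0 (c * Poly_Mapping.lookup F w) * mon_eval V h (w + d) =
      Poly_Mapping.single 0 c * mon_eval V h d * (Poly_Mapping.single 0 (Poly_Mapping.lookup F w) * mon_eval V h w)"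
      by (simp only: mon_eval_add mult_ac)
  qed
  also have "\<dots> = Poly_Mapping.single 0 c * mon_eval V h d * poly_eval V h F"
    by (simp only: poly_eval_def sum_distrib_left)
  finally show ?thesis .
qed

text \<open>
  The Rees algebra \<open>\<Oplus>\<^sub>k I\<^sup>k\<close> of the ideal generated by \<open>a 0, \<dots>, a (m - 1)\<close> is a quotient of the
  polynomial ring in the variables \<open>x\<^sub>i\<close> of \<open>S\<close> (encoded as \<open>Inl i\<close>) and new variables \<open>y\<^sub>j\<close> with \<open>j < m\<close>
  (encoded as \<open>Inr j\<close>).  The number of generators is not known at the level of types; hence the
  type \<open>nat\<close> for the indices \<open>j\<close>, together with the restriction to \<open>rees_vars\<close>.
\<close>

definition rees_vars :: "nat \<Rightarrow> ('n + nat) set"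
  where "rees_vars m = range Inl \<union> Inr ` {..<m}"

text \<open>The substitution \<open>x\<^sub>i \<mapsto> x\<^sub>i\<close>, \<open>y\<^sub>j \<mapsto> a j\<close>.\<close>

definition rees_subst :: "(nat \<Rightarrow> ('n, 'k::field) mpoly) \<Rightarrow> 'n + nat \<Rightarrow> ('n, 'k) mpoly"
  where "rees_subst a = case_sum (\<lambda>i. Poly_Mapping.single (Poly_Mapping.single i 1) 1) a"

text \<open>The degree of a monomial in the variables \<open>y\<^sub>j\<close>.\<close>

definition rees_degree :: "nat \<Rightarrow> ('n + nat \<Rightarrow>\<^sub>0 nat) \<Rightarrow> nat"
  where "rees_degree m u = (\<Sum>j<m. Poly_Mapping.lookup u (Inr j))"

text \<open>
  The polynomials in the variables \<open>rees_vars m\<close> that are homogeneous of degree \<open>k\<close> in the \<open>y\<^sub>j\<close>.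
\<close>

definition rees_piece :: "nat \<Rightarrow> nat \<Rightarrow> ('n + nat, 'k::field) mpoly set"
  where "rees_piece m k =
    {F. \<forall>u\<in>Poly_Mapping.keys F. Poly_Mapping.keys u \<subseteq> rees_vars m \<and> rees_degree m u = k}"

lemma finite_rees_vars [simp]: "finite (rees_vars m :: ('n::finite + nat) set)"
  by (simp add: rees_vars_def)

lemma rees_degree_0 [simp]: "rees_degree m 0 = 0"
  by (simp add: rees_degree_def)

lemma rees_degree_add: "rees_degree m (u + w) = rees_degree m u + rees_degree m w"
  by (simp add: rees_degree_def lookup_add sum.distrib)

lemma rees_degree_Inl [simp]: "rees_degree m (Poly_Mapping.single (Inl i) c) = 0"
  by (simp add: rees_degree_def lookup_single)

lemma rees_degree_Inr [simp]:
  assumes "j < m"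
  shows "rees_degree m (Poly_Mapping.single (Inr j) (Suc 0)) = 1"
proof -
  have "rees_degree m (Poly_Mapping.single (Inr j) (Suc 0)) = (\<Sum>i<m. if j = i then 1 else 0)"
    unfolding rees_degree_def by (intro sum.cong) (auto simp: lookup_single)
  then show ?thesis using assms by simp
qed

lemma rees_piece_0: "0 \<in> rees_piece m k"
  by (simp add: rees_piece_def)

lemma rees_piece_add: "F \<in> rees_piece m k \<Longrightarrow> G \<in> rees_piece m k \<Longrightarrow> F + G \<in> rees_piece m k"
  using keys_add[of F G] unfolding rees_piece_def by blast

lemma rees_piece_diff: 
  assumes "F \<in> rees_piece m k" "G \<in> rees_piece m k" 
  shows "F - G \<in> rees_piece m k"
proof -
  have "Poly_Mapping.keys (F - G) \<subseteq> Poly_Mapping.keys F \<union> Poly_Mapping.keys G"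
    by (auto simp: in_keys_iff lookup_minus)
  then show ?thesis using assms unfolding rees_piece_def by blast
qed

lemma rees_piece_shift:
  assumes "F \<in> rees_piece m k" "Poly_Mapping.keys u \<subseteq> rees_vars m"
  shows "Poly_Mapping.single u c * F \<in> rees_piece m (k + rees_degree m u)"
  unfolding rees_piece_def
proof (intro CollectI ballI)
  fix x assume "x \<in> Poly_Mapping.keys (Poly_Mapping.single u c * F)"
  then obtain w where "w \<in> Poly_Mapping.keys F" "x = w + u" using keys_single_mult by blast
  then show "Poly_Mapping.keys x \<subseteq> rees_vars m \<and> rees_degree m x = k + rees_degree m u"
    using assms keys_add[of w u] by (auto simp: rees_piece_def rees_degree_add)
qed

text \<open>
  The image is closed under multiplication by constants and by the variables \<open>x\<^sub>i\<close>, hence by monomials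
  and by arbitrary polynomials.
\<close>

lemma rees_image_ideal:
  fixes a :: "nat \<Rightarrow> ('n::finite, 'k::field) mpoly"
  shows "ideal (poly_eval (rees_vars m) (rees_subst a) ` rees_piece m k) polyring"
proof -
  let ?e = "poly_eval (rees_vars m) (rees_subst a)"
  let ?J = "?e ` rees_piece m k"
  have zero: "0 \<in> ?J" using rees_piece_0[of m k] by (rule rev_image_eqI) simp
  have add: "f + g \<in> ?J" if fg: "f \<in> ?J" "g \<in> ?J" for f g
  proof -
    obtain F G where "F \<in> rees_piece m k" "f = ?e F" "G \<in> rees_piece m k" "g = ?e G"
      using fg by blast
    then have "F + G \<in> rees_piece m k" "f + g = ?e (F + G)"
      by (simp_all add: rees_piece_add poly_eval_add)
    then show ?thesis by blast
  qed
  have const: "Poly_Mapping.single 0 c * f \<in> ?J" if f: "f \<in> ?J" for c f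
  proof -
    obtain F where F: "F \<in> rees_piece m k" "f = ?e F" using f by blast
    have "?e (Poly_Mapping.single 0 c * F) = Poly_Mapping.single 0 c * f"
      unfolding poly_eval_shift F(2) by simp
    moreover have "Poly_Mapping.single 0 c * F \<in> rees_piece m k"
      using rees_piece_shift[OF F(1), of 0 c] by simp
    ultimately show ?thesis by (metis image_eqI)
  qed
  have var: "Poly_Mapping.single (Poly_Mapping.single i 1) 1 * f \<in> ?J" if f: "f \<in> ?J" for i f
  proof -
    obtain F where F: "F \<in> rees_piece m k" "f = ?e F" using f by blast
    have i: "Inl i \<in> rees_vars m" by (simp add: rees_vars_def)
    have "?e (Poly_Mapping.single (Poly_Mapping.single (Inl i) 1) 1 * F) =
        Poly_Mapping.single (Poly_Mapping.single i 1) 1 * f"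
      unfolding poly_eval_shift mon_eval_single[OF finite_rees_vars i] F(2)
      by (simp add: rees_subst_def)
    moreover have "Poly_Mapping.single (Poly_Mapping.single (Inl i) 1) 1 * F \<in> rees_piece m k"
      using rees_piece_shift[OF F(1), of "Poly_Mapping.single (Inl i) 1" 1] i by simp
    ultimately show ?thesis by (metis image_eqI)
  qed
  have monom: "Poly_Mapping.single w 1 * f \<in> ?J" if f: "f \<in> ?J" for w f
  proof -
    have "Poly_Mapping.keys w \<subseteq> UNIV" by simp
    then show ?thesis
    proof (induction w rule: exponent_induct)
      case zero
      show ?case using f by simp
    next
      case (step v u)
      have "Poly_Mapping.single (Poly_Mapping.single v 1 + u) (1::'k) =
        Poly_Mapping.single (Poly_Mapping.single v 1) 1 * Poly_Mapping.single u 1"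
        by (simp add: mult_single)
      then show ?case using var[OF step(3), of v] by (simp only: mult.assoc)
    qed
  qed
  show ?thesis
    unfolding ideal_iff
  proof (intro conjI ballI allI)
    fix f r assume f: "f \<in> ?J"
    have "(\<Sum>w\<in>A. Poly_Mapping.single w (Poly_Mapping.lookup r w)) * f \<in> ?J" for A
    proof (induction A rule: infinite_finite_induct)
      case (insert w A)
      have "Poly_Mapping.single w (Poly_Mapping.lookup r w) =
        Poly_Mapping.single 0 (Poly_Mapping.lookup r w) * Poly_Mapping.single w 1"
        by (simp add: mult_single)
      then have "Poly_Mapping.single w (Poly_Mapping.lookup r w) * f \<in> ?J"
        using const[OF monom[OF f]] by (simp only: mult.assoc)
      then show ?case using insert add by (simp add: distrib_right)
    qed (use zero in simp_all)
    then show "r * f \<in> ?J" using sum_monomials[of r] by metis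
  qed (use zero add in auto)
qed

lemma ideal_power_subset_rees_image:
  fixes a :: "nat \<Rightarrow> ('n::finite, 'k::field) mpoly"
  assumes I: "I = Idl\<^bsub>polyring\<^esub> (a ` {..<m})"
  shows "ideal_power I k \<subseteq> poly_eval (rees_vars m) (rees_subst a) ` rees_piece m k"
proof (induction k)
  case 0
  let ?e = "poly_eval (rees_vars m) (rees_subst a)"
  have "1 \<in> rees_piece m 0" by (simp add: rees_piece_def)
  moreover have "?e 1 = 1" using poly_eval_def[of "rees_vars m" "rees_subst a" 1] by simp
  ultimately have "1 \<in> ?e ` rees_piece m 0" by (metis image_eqI)
  then show ?case using ideal_eq_UNIV[OF rees_image_ideal] by blast
next
  case (Suc k)
  let ?e = "poly_eval (rees_vars m) (rees_subst a)"
  let ?J = "?e ` rees_piece m (Suc k)"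
  have id: "ideal ?J polyring" by (rule rees_image_ideal)
  \<comment> \<open>To see that \<open>I\<close> multiplies the image in degree \<open>k\<close> into the one in degree \<open>k + 1\<close>, it suffices to
    check the generators, since the multipliers with this property form an ideal.\<close>
  define N where "N = {g. \<forall>f\<in>?e ` rees_piece m k. f * g \<in> ?J}"
  have "ideal N polyring"
    unfolding ideal_iff N_def
    using ideal_zero[OF id] ideal_add[OF id] ideal_mult_left[OF id]
    by (simp add: distrib_left mult.left_commute)
  moreover have "a ` {..<m} \<subseteq> N"
  proof safe
    fix j assume j: "j < m"
    then have jV: "Inr j \<in> rees_vars m" by (simp add: rees_vars_def)
    have "?e F * a j \<in> ?J" if F: "F \<in> rees_piece m k" for F
    proof -
      have "?e (Poly_Mapping.single (Poly_Mapping.single (Inr j) 1) 1 * F) = ?e F * a j"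
        unfolding poly_eval_shift mon_eval_single[OF finite_rees_vars jV]
        by (simp add: rees_subst_def mult.commute)
      moreover have "Poly_Mapping.single (Poly_Mapping.single (Inr j) 1) 1 * F \<in> rees_piece m (Suc k)"
        using rees_piece_shift[OF F, of "Poly_Mapping.single (Inr j) 1" 1] jV j by simp
      ultimately show ?thesis by (metis image_eqI)
    qed
    then show "a j \<in> N" unfolding N_def by auto
  qed
  ultimately have "I \<subseteq> N" unfolding I by (rule genideal_least)
  then have prod: "f * g \<in> ?J" if "f \<in> ideal_power I k" "g \<in> I" for f g
    using that Suc unfolding N_def by blast
  show ?case
    unfolding ideal_power_Suc by (rule ideal_prod_subset[OF prod ideal_add[OF id]])
qed

section \<open>The Artin-Rees lemma and Ratliff's theorem\<close>

text \<open>
  A family of ideals \<open>L k \<subseteq> I\<^sup>k\<close> with \<open>I L k \<subseteq> L (k + 1)\<close> is a graded ideal of the Rees algebra, hence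
  finitely generated, and beyond the degrees of its generators it satisfies \<open>L (k + 1) = I L k\<close>.
  Concretely, the preimages \<open>M k\<close> of \<open>L k\<close> in the polynomial ring that presents the Rees algebra have
  finitely many generators; a term of weight at least \<open>1\<close> is divisible by some \<open>y\<^sub>i\<close>.
\<close>

lemma artin_rees:
  fixes L :: "nat \<Rightarrow> ('n::finite, 'k::field) mpoly set"
  assumes fg: "finite G" "I = Idl\<^bsub>polyring\<^esub> G"
    and L: "\<And>k. ideal (L k) polyring" "\<And>k. L k \<subseteq> ideal_power I k"
    and step: "\<And>k f g. f \<in> L k \<Longrightarrow> g \<in> I \<Longrightarrow> g * f \<in> L (Suc k)"
  shows "\<exists>k0. \<forall>k\<ge>k0. L (Suc k) \<subseteq> ideal_prod polyring (L k) I"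
proof -
  obtain m and a :: "nat \<Rightarrow> ('n, 'k) mpoly" where "G = a ` {..<m}"
    using finite_imp_nat_seg_image_inj_on[OF fg(1)] by (auto simp: lessThan_def)
  then have I: "I = Idl\<^bsub>polyring\<^esub> (a ` {..<m})" using fg(2) by simp
  have aI: "a j \<in> I" if "j < m" for j
    using that genideal_superset[of "a ` {..<m}"] unfolding I by auto
  have idI: "ideal I polyring" unfolding I by (rule ideal_genideal)
  let ?V = "rees_vars m :: ('n + nat) set"
  let ?mon = "mon_eval ?V (rees_subst a)"
  let ?e = "poly_eval ?V (rees_subst a)"
  define M where "M k = {F \<in> rees_piece m k. ?e F \<in> L k}" for k
  have mon: "?mon u * f \<in> L (k + rees_degree m u)" if u: "Poly_Mapping.keys u \<subseteq> ?V" and f: "f \<in> L k" for u f k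
    using u
  proof (induction u rule: exponent_induct)
    case zero
    show ?case using f by simp
  next
    case (step v u)
    have eq: "?mon (Poly_Mapping.single v 1 + u) * f = rees_subst a v * (?mon u * f)"
      by (simp only: mon_eval_add mon_eval_single[OF finite_rees_vars step(1)] mult.assoc)
    show ?case
    proof (cases v)
      case (Inl i)
      then show ?thesis unfolding eq using ideal_mult_left[OF L(1) step(3)]
        by (simp add: rees_degree_add)
    next
      case (Inr j)
      then have j: "j < m" using step(1) by (auto simp: rees_vars_def)
      show ?thesis unfolding eq
        using assms(5)[OF step(3) aI[OF j]] j Inr by (simp add: rees_degree_add rees_subst_def)
    qed
  qed
  have shift: "Poly_Mapping.single u c * F \<in> M (k + rees_degree m u)"
    if F: "F \<in> M k" and u: "Poly_Mapping.keys u \<subseteq> ?V" for F u k c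
  proof -
    have "?e (Poly_Mapping.single u c * F) \<in> L (k + rees_degree m u)"
      unfolding poly_eval_shift mult.assoc
      by (rule ideal_mult_left[OF L(1)], rule mon[OF u]) (use F in \<open>simp add: M_def\<close>)
    moreover have "F \<in> rees_piece m k" using F by (simp add: M_def)
    ultimately show ?thesis using rees_piece_shift[OF _ u] unfolding M_def by blast
  qed
  have "\<exists>B. finite B \<and> (\<forall>(j, G)\<in>B. G \<in> M j) \<and>
    (\<forall>k F Q. F \<in> M k \<longrightarrow> 0 \<in> Q \<longrightarrow> (\<forall>F\<in>Q. \<forall>G\<in>Q. F + G \<in> Q) \<longrightarrow>
      (\<forall>(j, G)\<in>B. \<forall>u c. Poly_Mapping.keys u \<subseteq> ?V \<longrightarrow> j + rees_degree m u = k \<longrightarrow>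
        Poly_Mapping.single u c * G \<in> Q) \<longrightarrow> F \<in> Q)"
  proof (rule homogeneous_generators[where M = M and \<delta> = "rees_degree m" and V = "rees_vars m"])
    show "F - G \<in> M k" if "F \<in> M k" "G \<in> M k" for k F G
      using that rees_piece_diff[of F m k G] ideal_diff[OF L(1)] by (simp add: M_def poly_eval_diff)
    show "Poly_Mapping.keys u \<subseteq> rees_vars m \<and> rees_degree m u = k"
      if "F \<in> M k" "u \<in> Poly_Mapping.keys F" for k F u
      using that unfolding M_def rees_piece_def by blast
  qed (use shift in \<open>auto simp: rees_degree_add\<close>)
  then obtain B where B: "finite B" "\<forall>(j, G)\<in>B. G \<in> M j"
    and gen: "\<forall>k F Q. F \<in> M k \<longrightarrow> 0 \<in> Q \<longrightarrow> (\<forall>F\<in>Q. \<forall>G\<in>Q. F + G \<in> Q) \<longrightarrow>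
      (\<forall>(j, G)\<in>B. \<forall>u c. Poly_Mapping.keys u \<subseteq> ?V \<longrightarrow> j + rees_degree m u = k \<longrightarrow>
        Poly_Mapping.single u c * G \<in> Q) \<longrightarrow> F \<in> Q"
    by (elim exE conjE)
  obtain k0 where k0: "\<And>j G. (j, G) \<in> B \<Longrightarrow> j \<le> k0"
  proof
    show "j \<le> Max (fst ` B)" if "(j, G) \<in> B" for j G
      using that B(1) by (intro Max_ge) (auto intro: rev_image_eqI)
  qed
  show ?thesis
  proof (intro exI[of _ k0] allI impI subsetI)
    fix k f assume k: "k0 \<le> k" and f: "f \<in> L (Suc k)"
    let ?P = "ideal_prod polyring (L k) I"
    have idP: "ideal ?P polyring" by (rule ideal_ideal_prod[OF L(1) idI])
    obtain F where F: "F \<in> rees_piece m (Suc k)" "f = ?e F"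
      using f L(2) ideal_power_subset_rees_image[OF I] by blast
    then have FM: "F \<in> M (Suc k)" using f by (simp add: M_def)
    have "F \<in> {F. ?e F \<in> ?P}"
    proof (rule gen[THEN spec, THEN spec, THEN spec, THEN mp, OF FM, THEN mp, THEN mp, THEN mp])
      show "0 \<in> {F. ?e F \<in> ?P}" by (simp add: ideal_zero[OF idP])
      show "\<forall>F\<in>{F. ?e F \<in> ?P}. \<forall>G\<in>{F. ?e F \<in> ?P}. F + G \<in> {F. ?e F \<in> ?P}"
        by (simp add: poly_eval_add ideal_add[OF idP])
      have "?e (Poly_Mapping.single u c * H) \<in> ?P"
        if B': "(j, H) \<in> B" and u: "Poly_Mapping.keys u \<subseteq> ?V" and deg: "j + rees_degree m u = Suc k" for j H u c
      proof -
        have "rees_degree m u \<noteq> 0" using k0[OF B'] k deg by simp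
        then obtain i where i: "i < m" "Poly_Mapping.lookup u (Inr i) \<noteq> 0"
          unfolding rees_degree_def by (meson lessThan_iff sum.neutral)
        define w where "w = u - Poly_Mapping.single (Inr i) 1"
        have uw: "u = Poly_Mapping.single (Inr i) 1 + w"
          unfolding w_def by (rule exponent_split) (use i in \<open>simp add: in_keys_iff\<close>)
        have "rees_degree m u = Suc (rees_degree m w)"
          unfolding uw using i(1) by (simp add: rees_degree_add)
        then have k': "j + rees_degree m w = k" using deg by simp
        have "Poly_Mapping.keys w \<subseteq> ?V"
          using u unfolding w_def by (auto simp: in_keys_iff lookup_minus)
        then have "Poly_Mapping.single w c * H \<in> M k"
          using shift[of H j w c] B(2) B' k' by auto
        then have "?e (Poly_Mapping.single w c * H) \<in> L k" by (simp add: M_def)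
        then have "?e (Poly_Mapping.single w c * H) * a i \<in> ?P"
          using aI[OF i(1)] by (rule ideal_prod_mem)
        moreover have "?e (Poly_Mapping.single u c * H) = ?e (Poly_Mapping.single w c * H) * a i"
        proof -
          have "Inr i \<in> ?V" using i(1) by (simp add: rees_vars_def)
          then show ?thesis
            unfolding poly_eval_shift uw mon_eval_add mon_eval_single[OF finite_rees_vars \<open>Inr i \<in> ?V\<close>]
            by (simp add: rees_subst_def mult_ac)
        qed
        ultimately show ?thesis by simp
      qed
      then show "\<forall>(j, G)\<in>B. \<forall>u c. Poly_Mapping.keys u \<subseteq> ?V \<longrightarrow> j + rees_degree m u = Suc k \<longrightarrow>
        Poly_Mapping.single u c * G \<in> {F. ?e F \<in> ?P}"
        by blast
    qed
    then show "f \<in> ?P" using F(2) by simp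
  qed
qed

lemma ideal_colon_set:
  fixes J :: "'a::comm_ring_1 set"
  assumes J: "ideal J ring_of_type_algebra"
  shows "ideal {f. \<forall>g\<in>I. f * g \<in> J} ring_of_type_algebra"
  unfolding ideal_iff
  using ideal_zero[OF J] ideal_add[OF J] ideal_mult_left[OF J]
  by (auto simp: distrib_right mult.assoc)

text \<open>
  Ratliff's theorem: \<open>(I\<^sup>k\<^sup>+\<^sup>1 : I) \<subseteq> I\<^sup>k\<close> for all large \<open>k\<close>, by two applications of the Artin-Rees lemma.
\<close>

lemma ideal_power_colon_eventually:
  fixes I :: "('n::finite, 'k::field) mpoly set"
  assumes I: "ideal I polyring" "I \<noteq> {0}"
  shows "\<exists>K. \<forall>k\<ge>K. \<forall>f. (\<forall>g\<in>I. f * g \<in> ideal_power I (Suc k)) \<longrightarrow> f \<in> ideal_power I k"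
proof -
  obtain G where G: "finite G" "I = Idl\<^bsub>polyring\<^esub> G"
    using ideal_finitely_generated[OF I(1)] by blast
  obtain a where a: "a \<in> I" "a \<noteq> 0" using I ideal_zero[OF I(1)] by blast
  have idk: "ideal (ideal_power I k) polyring" for k by (rule ideal_ideal_power[OF I(1)])
  \<comment> \<open>First step: \<open>A k = I\<^sup>k \<inter> (a)\<close> yields a constant \<open>c\<close> such that \<open>(I\<^sup>c\<^sup>+\<^sup>k : a) \<subseteq> I\<^sup>k\<close> for all \<open>k\<close>.\<close>
  define A where "A k = {f. f \<in> ideal_power I k \<and> (\<exists>r. f = r * a)}" for k
  have idA: "ideal (A k) polyring" for k
    unfolding ideal_iff A_def
    using ideal_zero[OF idk] ideal_add[OF idk] ideal_mult_left[OF idk]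
    by (auto simp flip: distrib_right mult.assoc intro: exI[of _ 0])
  have "\<exists>k0. \<forall>k\<ge>k0. A (Suc k) \<subseteq> ideal_prod polyring (A k) I"
  proof (rule artin_rees[OF G idA])
    show "A k \<subseteq> ideal_power I k" for k by (auto simp: A_def)
    show "g * f \<in> A (Suc k)" if fg: "f \<in> A k" "g \<in> I" for k f g
    proof -
      obtain r where "f = r * a" "f \<in> ideal_power I k" using fg(1) by (auto simp: A_def)
      moreover from this have "f * g \<in> ideal_power I (Suc k)"
        unfolding ideal_power_Suc using fg(2) by (intro ideal_prod_mem)
      ultimately show ?thesis by (auto simp: A_def mult_ac intro!: exI[of _ "r * g"])
    qed
  qed
  then obtain c where c: "\<And>k. k \<ge> c \<Longrightarrow> A (Suc k) \<subseteq> ideal_prod polyring (A k) I" by blast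
  have A_sub: "A (c + k) \<subseteq> {f. \<exists>r\<in>ideal_power I k. f = r * a}" for k
  proof (induction k)
    case 0
    show ?case unfolding ideal_power_0 by (auto simp: A_def)
  next
    case (Suc k)
    have "A (c + Suc k) \<subseteq> ideal_prod polyring (A (c + k)) I" using c[of "c + k"] by simp
    also have "\<dots> \<subseteq> {f. \<exists>r\<in>ideal_power I (Suc k). f = r * a}"
    proof (rule ideal_prod_subset)
      fix x y assume "x \<in> A (c + k)" "y \<in> I"
      then obtain r where "r \<in> ideal_power I k" "x = r * a" using Suc by blast
      moreover from this have "r * y \<in> ideal_power I (Suc k)"
        unfolding ideal_power_Suc using \<open>y \<in> I\<close> by (intro ideal_prod_mem)
      ultimately have "x * y = (r * y) * a" "r * y \<in> ideal_power I (Suc k)"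
        by (simp_all only: mult_ac)
      then show "x * y \<in> {f. \<exists>r\<in>ideal_power I (Suc k). f = r * a}" by blast
    next
      fix x y assume "x \<in> {f. \<exists>r\<in>ideal_power I (Suc k). f = r * a}"
        "y \<in> {f. \<exists>r\<in>ideal_power I (Suc k). f = r * a}"
      then obtain r s where "r \<in> ideal_power I (Suc k)" "x = r * a"
        "s \<in> ideal_power I (Suc k)" "y = s * a" by blast
      then have "r + s \<in> ideal_power I (Suc k)" "x + y = (r + s) * a"
        by (simp_all only: distrib_right ideal_add[OF idk])
      then show "x + y \<in> {f. \<exists>r\<in>ideal_power I (Suc k). f = r * a}" by blast
    qed
    finally show ?case .
  qed
  have bound: "f \<in> ideal_power I k" if "f * a \<in> ideal_power I (c + k)" for f k
  proof -
    have "f * a \<in> A (c + k)" using that by (auto simp: A_def)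
    then obtain r where r: "r \<in> ideal_power I k" "f * a = r * a" using A_sub by blast
    have "(f - r) * a = 0" using r(2) by (simp add: left_diff_distrib)
    then have "f - r = 0" using mpoly_no_zero_divisors a(2) by blast
    then show ?thesis using r(1) by simp
  qed
  \<comment> \<open>Second step: by the first one, the ideals \<open>L k = (I\<^sup>c\<^sup>+\<^sup>k\<^sup>+\<^sup>1 : I)\<close> are contained in \<open>I\<^sup>k\<close>, so
    \<open>L (k + 1) = I L k \<subseteq> I\<^sup>c\<^sup>+\<^sup>k\<^sup>+\<^sup>1\<close> for large \<open>k\<close>.\<close>
  define L where "L k = {f. \<forall>g\<in>I. f * g \<in> ideal_power I (Suc (c + k))}" for k
  have idL: "ideal (L k) polyring" for k
    unfolding L_def by (rule ideal_colon_set[OF idk])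
  have "\<exists>k0. \<forall>k\<ge>k0. L (Suc k) \<subseteq> ideal_prod polyring (L k) I"
  proof (rule artin_rees[OF G idL])
    show "L k \<subseteq> ideal_power I k" for k
    proof
      fix f assume "f \<in> L k"
      then have "f * a \<in> ideal_power I (c + Suc k)" using a(1) by (simp only: L_def add_Suc_right) blast
      then have "f \<in> ideal_power I (Suc k)" by (rule bound)
      then show "f \<in> ideal_power I k" using ideal_power_decreasing[OF I(1)] by blast
    qed
    show "g * f \<in> L (Suc k)" if fg: "f \<in> L k" "g \<in> I" for k f g
    proof -
      have "g * f * h \<in> ideal_power I (Suc (Suc (c + k)))" if h: "h \<in> I" for h
      proof -
        have "f * h \<in> ideal_power I (Suc (c + k))" using fg(1) h unfolding L_def by blast
        then have "f * h * g \<in> ideal_power I (Suc (Suc (c + k)))"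
          unfolding ideal_power_Suc[of I "Suc (c + k)"] using fg(2) by (rule ideal_prod_mem)
        moreover have "f * h * g = g * f * h" by (simp only: mult_ac)
        ultimately show ?thesis by metis
      qed
      then show ?thesis unfolding L_def add_Suc_right by blast
    qed
  qed
  then obtain k0 where k0: "\<And>k. k \<ge> k0 \<Longrightarrow> L (Suc k) \<subseteq> ideal_prod polyring (L k) I" by blast
  show ?thesis
  proof (intro exI[of _ "Suc (c + k0)"] allI impI)
    fix k f
    assume k: "Suc (c + k0) \<le> k" and f: "\<forall>g\<in>I. f * g \<in> ideal_power I (Suc k)"
    define j where "j = k - Suc c"
    have kj: "k = Suc (c + j)" "j \<ge> k0" using k by (simp_all add: j_def)
    have "f \<in> L (Suc j)" using f unfolding L_def kj(1) add_Suc_right by blast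
    then have "f \<in> ideal_prod polyring (L j) I" using k0[OF kj(2)] by blast
    moreover have "ideal_prod polyring (L j) I \<subseteq> ideal_power I k"
      unfolding kj(1)
      by (rule ideal_prod_subset) (simp only: L_def, blast, rule ideal_add[OF idk])
    ultimately show "f \<in> ideal_power I k" by blast
  qed
qed

section \<open>Homogeneous components\<close>

lemma mon_deg_add: "mon_deg (u + w) = mon_deg u + mon_deg w"
  by (simp add: mon_deg_def lookup_add sum.distrib)

lemma lookup_hom_component:
  "Poly_Mapping.lookup (hom_component d f) m = (if mon_deg m = d then Poly_Mapping.lookup f m else 0)"
proof -
  have "Poly_Mapping.lookup (hom_component d f) m =
    (\<Sum>x\<in>{x \<in> Poly_Mapping.keys f. mon_deg x = d}. if m = x then Poly_Mapping.lookup f x else 0)"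
    unfolding hom_component_def lookup_sum by (intro sum.cong) (auto simp: lookup_single when_def)
  then show ?thesis by (auto simp: in_keys_iff)
qed

lemma hom_component_0 [simp]: "hom_component d 0 = 0"
  by (rule poly_mapping_eqI) (simp add: lookup_hom_component)

lemma hom_component_add: "hom_component d (f + g) = hom_component d f + hom_component d g"
  by (rule poly_mapping_eqI) (simp add: lookup_hom_component lookup_add)

lemma hom_component_sum: "hom_component d (\<Sum>x\<in>A. f x) = (\<Sum>x\<in>A. hom_component d (f x))"
  by (induction A rule: infinite_finite_induct) (simp_all add: hom_component_add)

lemma hom_component_in_graded_piece: "hom_component d f \<in> graded_piece d"
  by (auto simp: graded_piece_def in_keys_iff lookup_hom_component split: if_splits)

lemma hom_component_of_homogeneous:
  assumes "f \<in> graded_piece e"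
  shows "hom_component d f = (if d = e then f else 0)"
proof (rule poly_mapping_eqI)
  fix m
  show "Poly_Mapping.lookup (hom_component d f) m = Poly_Mapping.lookup (if d = e then f else 0) m"
    using assms by (auto simp: lookup_hom_component graded_piece_def in_keys_iff)
qed

lemma hom_component_eq_0:
  assumes "d \<notin> mon_deg ` Poly_Mapping.keys f"
  shows "hom_component d f = 0"
  using assms by (intro poly_mapping_eqI) (auto simp: lookup_hom_component in_keys_iff)

lemma sum_hom_components:
  assumes "finite D" "mon_deg ` Poly_Mapping.keys f \<subseteq> D"
  shows "(\<Sum>d\<in>D. hom_component d f) = f"
proof (rule poly_mapping_eqI)
  fix m
  have "Poly_Mapping.lookup (\<Sum>d\<in>D. hom_component d f) m =
    (\<Sum>d\<in>D. if mon_deg m = d then Poly_Mapping.lookup f m else 0)"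
    unfolding lookup_sum by (simp add: lookup_hom_component)
  also have "\<dots> = Poly_Mapping.lookup f m"
  proof (cases "m \<in> Poly_Mapping.keys f")
    case True
    then have "mon_deg m \<in> D" using assms(2) by blast
    then show ?thesis using assms(1) by simp
  next
    case False
    then have "Poly_Mapping.lookup f m = 0" by (simp add: in_keys_iff)
    then show ?thesis by (intro trans[OF sum.neutral]) auto
  qed
  finally show "Poly_Mapping.lookup (\<Sum>d\<in>D. hom_component d f) m = Poly_Mapping.lookup f m" .
qed

lemma hom_components_in_ideal:
  assumes "ideal J polyring" "\<And>d. hom_component d f \<in> J"
  shows "f \<in> J"
  using ideal_sum[OF assms(1), of "mon_deg ` Poly_Mapping.keys f" "\<lambda>d. hom_component d f"] assms(2)
    sum_hom_components[of "mon_deg ` Poly_Mapping.keys f" f] by simp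

lemma graded_piece_mult:
  assumes "f \<in> graded_piece d" "g \<in> graded_piece e"
  shows "f * g \<in> graded_piece (d + e)"
  unfolding graded_piece_def
proof (intro CollectI ballI)
  fix m assume "m \<in> Poly_Mapping.keys (f * g)"
  then obtain u w where "m = u + w" "u \<in> Poly_Mapping.keys f" "w \<in> Poly_Mapping.keys g"
    using keys_mult[of f g] by blast
  then show "mon_deg m = d + e" using assms by (auto simp: graded_piece_def mon_deg_add)
qed

lemma hom_component_mult_homogeneous:
  assumes "h \<in> graded_piece e"
  shows "hom_component n (h * f) = (if e \<le> n then h * hom_component (n - e) f else 0)"
proof -
  let ?D = "mon_deg ` Poly_Mapping.keys f \<union> {..n}"
  have "f = (\<Sum>d\<in>?D. hom_component d f)" by (rule sum_hom_components[symmetric]) auto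
  then have "h * f = (\<Sum>d\<in>?D. h * hom_component d f)" by (metis sum_distrib_left)
  then have "hom_component n (h * f) = (\<Sum>d\<in>?D. hom_component n (h * hom_component d f))"
    by (simp only: hom_component_sum)
  also have "\<dots> = (\<Sum>d\<in>?D. if d = n - e then (if e \<le> n then h * hom_component d f else 0) else 0)"
  proof (rule sum.cong[OF refl])
    fix d
    have "h * hom_component d f \<in> graded_piece (e + d)"
      by (rule graded_piece_mult[OF assms hom_component_in_graded_piece])
    then show "hom_component n (h * hom_component d f) =
      (if d = n - e then (if e \<le> n then h * hom_component d f else 0) else 0)"
      by (subst hom_component_of_homogeneous) auto
  qed
  also have "\<dots> = (if e \<le> n then h * hom_component (n - e) f else 0)"
    by (subst sum.delta) auto
  finally show ?thesis .
qed

lemma hom_component_mult: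
  "hom_component n (g * f) = (\<Sum>i\<le>n. hom_component i g * hom_component (n - i) f)"
proof -
  let ?D = "mon_deg ` Poly_Mapping.keys g \<union> {..n}"
  have "g = (\<Sum>i\<in>?D. hom_component i g)" by (rule sum_hom_components[symmetric]) auto
  then have "g * f = (\<Sum>i\<in>?D. hom_component i g * f)" by (metis sum_distrib_right)
  then have "hom_component n (g * f) = (\<Sum>i\<in>?D. hom_component n (hom_component i g * f))"
    by (simp only: hom_component_sum)
  also have "\<dots> = (\<Sum>i\<in>?D. if i \<le> n then hom_component i g * hom_component (n - i) f else 0)"
    by (simp only: hom_component_mult_homogeneous[OF hom_component_in_graded_piece])
  also have "\<dots> = (\<Sum>i\<le>n. if i \<le> n then hom_component i g * hom_component (n - i) f else 0)"
    by (rule sum.mono_neutral_right) auto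
  also have "\<dots> = (\<Sum>i\<le>n. hom_component i g * hom_component (n - i) f)"
    by (rule sum.cong) auto
  finally show ?thesis .
qed

lemma graded_ideal_power:
  assumes "graded_ideal I"
  shows "graded_ideal (ideal_power I k)"
proof -
  have I: "ideal I polyring" "\<And>f d. f \<in> I \<Longrightarrow> hom_component d f \<in> I"
    using assms by (auto simp: graded_ideal_def)
  have idk: "ideal (ideal_power I k) polyring" for k by (rule ideal_ideal_power[OF I(1)])
  have "hom_component d f \<in> ideal_power I k" if "f \<in> ideal_power I k" for f d
    using that
  proof (induction k arbitrary: f d)
    case 0
    show ?case unfolding ideal_power_0 by simp
  next
    case (Suc k)
    have "ideal_power I (Suc k) \<subseteq> {f. \<forall>d. hom_component d f \<in> ideal_power I (Suc k)}"
      unfolding ideal_power_Suc[of I k]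
    proof (rule ideal_prod_subset)
      fix a b assume ab: "a \<in> ideal_power I k" "b \<in> I"
      have "hom_component i a * hom_component j b \<in> ideal_power I (Suc k)" for i j
        unfolding ideal_power_Suc by (rule ideal_prod_mem[OF Suc.IH[OF ab(1)] I(2)[OF ab(2)]])
      then have "hom_component d (a * b) \<in> ideal_power I (Suc k)" for d
        unfolding hom_component_mult by (intro ideal_sum[OF idk])
      then show "a * b \<in> {f. \<forall>d. hom_component d f \<in> ideal_prod polyring (ideal_power I k) I}"
        unfolding ideal_power_Suc by blast
    next
      fix x y assume "x \<in> {f. \<forall>d. hom_component d f \<in> ideal_prod polyring (ideal_power I k) I}"
        "y \<in> {f. \<forall>d. hom_component d f \<in> ideal_prod polyring (ideal_power I k) I}"
      then show "x + y \<in> {f. \<forall>d. hom_component d f \<in> ideal_prod polyring (ideal_power I k) I}"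
        using ideal_add[OF ideal_ideal_prod[OF idk I(1)]] by (simp add: hom_component_add)
    qed
    then show ?case using Suc.prems by blast
  qed
  then show ?thesis using idk by (auto simp: graded_ideal_def)
qed

section \<open>Associated primes\<close>

text \<open>
  A maximal element among the ideals \<open>(J : f)\<close> with \<open>f \<notin> J\<close> is prime.
\<close>

lemma Ass_nonempty:
  fixes J :: "('n::finite, 'k::field) mpoly set"
  assumes J: "ideal J polyring" "J \<noteq> UNIV"
  shows "Ass J \<noteq> {}"
proof -
  define \<A> where "\<A> = {colon J f | f. f \<notin> J}"
  have "\<A> \<noteq> {}" using J(2) unfolding \<A>_def by blast
  moreover have "ideal P polyring" if "P \<in> \<A>" for P
    using that ideal_colon[OF J(1)] unfolding \<A>_def by blast
  ultimately obtain P where P: "P \<in> \<A>" "\<And>Q. Q \<in> \<A> \<Longrightarrow> P \<subseteq> Q \<Longrightarrow> Q = P"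
    using family_of_ideals_has_maximal[of \<A>] by metis
  obtain f where f: "f \<notin> J" "P = colon J f" using P(1) unfolding \<A>_def by blast
  have "primeideal P polyring"
    unfolding primeideal_iff
  proof (intro conjI allI impI)
    show "ideal P polyring" unfolding f(2) by (rule ideal_colon[OF J(1)])
    have "1 \<notin> P" using f by (simp add: colon_def)
    then show "P \<noteq> UNIV" by blast
    fix a b assume ab: "a * b \<in> P"
    show "a \<in> P \<or> b \<in> P"
    proof (cases "b \<in> P")
      case False
      then have "b * f \<notin> J" using f(2) by (simp add: colon_def)
      moreover have "P \<subseteq> colon J (b * f)"
      proof
        fix x assume "x \<in> P"
        then have "b * (x * f) \<in> J"
          unfolding f(2) colon_def by (simp add: ideal_mult_left[OF J(1)])
        then show "x \<in> colon J (b * f)" by (simp add: colon_def mult.left_commute)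
      qed
      ultimately have "colon J (b * f) = P" using P(2) unfolding \<A>_def by blast
      moreover have "a \<in> colon J (b * f)" using ab f(2) by (simp add: colon_def mult.assoc)
      ultimately show ?thesis by blast
    qed simp
  qed
  then show ?thesis unfolding Ass_def using f(2) by blast
qed

text \<open>
  Among all \<open>F\<close> with \<open>(J : F) = p\<close>, take one with the fewest homogeneous components outside \<open>J\<close>, and
  let \<open>F\<^sub>d\<^sub>0\<close> be the lowest of these components.  A form \<open>h\<close> outside \<open>p\<close> cannot annihilate \<open>F\<^sub>d\<^sub>0\<close> modulo
  \<open>J\<close>: otherwise \<open>h F\<close> would be a witness for \<open>p\<close> with fewer components outside \<open>J\<close>.  This shows that
  \<open>p\<close> is graded, and then that \<open>(J : F\<^sub>d\<^sub>0) = p\<close>.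
\<close>

lemma homogeneous_witness:
  fixes J :: "('n::finite, 'k::field) mpoly set"
  assumes "graded_ideal J" and p: "primeideal p polyring" and f: "colon J f = p"
  shows "\<exists>d. \<exists>h\<in>graded_piece d. colon J h = p"
proof -
  have J: "ideal J polyring" and graded: "\<And>f d. f \<in> J \<Longrightarrow> hom_component d f \<in> J"
    using assms(1) by (auto simp: graded_ideal_def)
  define D where "D F = {d. hom_component d F \<notin> J}" for F
  have finD: "finite (D F)" for F
  proof (rule finite_subset)
    show "D F \<subseteq> mon_deg ` Poly_Mapping.keys F"
      using hom_component_eq_0 ideal_zero[OF J] unfolding D_def by fastforce
  qed simp
  obtain F where F: "colon J F = p" "\<And>F'. colon J F' = p \<Longrightarrow> card (D F) \<le> card (D F')"
    using ex_has_least_nat[of "\<lambda>F. colon J F = p" f "\<lambda>F. card (D F)"] f by blast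
  have memp: "g \<in> p \<longleftrightarrow> g * F \<in> J" for g using F(1) by (auto simp: colon_def)
  have "F \<notin> J" using memp[of 1] one_notin_prime[OF p] by simp
  then have "D F \<noteq> {}" using hom_components_in_ideal[OF J, of F] unfolding D_def by blast
  define d0 where "d0 = Min (D F)"
  have d0: "d0 \<in> D F" "\<And>d. d < d0 \<Longrightarrow> hom_component d F \<in> J"
    using Min_in[OF finD \<open>D F \<noteq> {}\<close>] Min_le[OF finD, of _ F] unfolding d0_def
    by (simp, metis (mono_tags, lifting) D_def leD mem_Collect_eq)
  have A: "h \<in> p" if h: "h \<in> graded_piece e" and hF: "h * hom_component d0 F \<in> J" for h e
  proof (rule ccontr)
    assume "h \<notin> p"
    then have "colon J (h * F) = p"
      using prime_mult_mem[OF p, of _ h] memp by (auto simp: colon_def mult.assoc[symmetric])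
    then have le: "card (D F) \<le> card (D (h * F))" by (rule F(2))
    have "D (h * F) \<subseteq> (\<lambda>j. j + e) ` (D F - {d0})"
    proof
      fix i assume i: "i \<in> D (h * F)"
      then have ni: "hom_component i (h * F) \<notin> J" by (simp add: D_def)
      then have ei: "e \<le> i" "h * hom_component (i - e) F \<notin> J"
        using ideal_zero[OF J] by (auto simp: hom_component_mult_homogeneous[OF h] split: if_splits)
      then have "i - e \<in> D F" "i - e \<noteq> d0"
        using ideal_mult_left[OF J] hF by (auto simp: D_def)
      then show "i \<in> (\<lambda>j. j + e) ` (D F - {d0})" using ei(1) by (intro image_eqI[of _ _ "i - e"]) auto
    qed
    then have "card (D (h * F)) \<le> card ((\<lambda>j. j + e) ` (D F - {d0}))"
      using finD by (intro card_mono) auto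
    also have "\<dots> \<le> card (D F - {d0})" by (rule card_image_le) (simp add: finD)
    also have "\<dots> < card (D F)" using d0(1) finD by (rule card_Diff1_less[rotated])
    finally show False using le by simp
  qed
  have B: "h * hom_component d F \<in> J" if h: "h \<in> graded_piece e" "h \<in> p" for h e d
    using graded[of "h * F" "e + d"] memp h(2) by (simp add: hom_component_mult_homogeneous[OF h(1)])
  have C: "hom_component e g \<in> p" if g: "g \<in> p" for g e
  proof (induction e rule: less_induct)
    case (less e)
    let ?t = "\<lambda>i. hom_component i g * hom_component (e + d0 - i) F"
    \<comment> \<open>In the component of degree \<open>e + d0\<close> of \<open>g F\<close>, the terms with \<open>i < e\<close> lie in \<open>J\<close> by induction and
      those with \<open>i > e\<close> by the choice of \<open>d0\<close>.\<close>
    have other: "?t i \<in> J" if i: "i \<in> {..e + d0} - {e}" for i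
    proof (cases "i < e")
      case True
      show ?thesis by (rule B[OF hom_component_in_graded_piece less.IH[OF True]])
    next
      case False
      then have "e + d0 - i < d0" using i by auto
      then show ?thesis by (intro ideal_mult_left[OF J] d0(2))
    qed
    have "(\<Sum>i\<le>e + d0. ?t i) \<in> J"
      using graded[of "g * F" "e + d0"] g memp by (simp only: hom_component_mult)
    moreover have "(\<Sum>i\<le>e + d0. ?t i) = ?t e + (\<Sum>i\<in>{..e + d0} - {e}. ?t i)"
      by (rule sum.remove) auto
    moreover have "(\<Sum>i\<in>{..e + d0} - {e}. ?t i) \<in> J" by (rule ideal_sum[OF J other])
    ultimately have "?t e \<in> J"
      using ideal_diff[OF J, of "\<Sum>i\<le>e + d0. ?t i" "\<Sum>i\<in>{..e + d0} - {e}. ?t i"] by simp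
    then show ?case using A[OF hom_component_in_graded_piece] by simp
  qed
  have "colon J (hom_component d0 F) = p"
  proof (intro equalityI subsetI)
    fix g assume "g \<in> p"
    then have "hom_component d0 F * hom_component e g \<in> J" for e
      using B[OF hom_component_in_graded_piece C, of g e d0] mult.commute[of "hom_component d0 F"]
      by metis
    then have "hom_component n (hom_component d0 F * g) \<in> J" for n
      using ideal_zero[OF J]
      by (simp add: hom_component_mult_homogeneous[OF hom_component_in_graded_piece])
    then have "hom_component d0 F * g \<in> J" by (rule hom_components_in_ideal[OF J])
    then show "g \<in> colon J (hom_component d0 F)" by (simp add: colon_def mult.commute)
  next
    fix g assume "g \<in> colon J (hom_component d0 F)"
    then have "hom_component d0 F * g \<in> J" by (simp add: colon_def mult.commute)
    then have "hom_component (d0 + e) (hom_component d0 F * g) \<in> J" for e by (rule graded)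
    then have "hom_component d0 F * hom_component e g \<in> J" for e
      by (simp add: hom_component_mult_homogeneous[OF hom_component_in_graded_piece])
    then have "hom_component e g * hom_component d0 F \<in> J" for e
      by (subst mult.commute)
    then have comps: "hom_component e g \<in> p" for e by (rule A[OF hom_component_in_graded_piece])
    have "ideal p polyring" using p by (simp add: primeideal_iff)
    then show "g \<in> p" using comps by (rule hom_components_in_ideal)
  qed
  then show ?thesis using hom_component_in_graded_piece by blast
qed

lemma prime_prod_mem:
  assumes "primeideal p (ring_of_type_algebra :: 'a::comm_ring_1 ring)" "finite A" "prod h A \<in> p"
  shows "\<exists>x\<in>A. h x \<in> p"
  using assms(2,3)
  by (induction A rule: finite_induct) (auto simp: one_notin_prime[OF assms(1)] prime_mult_mem[OF assms(1)])

text \<open>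
  Passage from \<open>I\<^sup>k\<close> to \<open>I\<^sup>k\<^sup>+\<^sup>1\<close> with a fixed prime, at any exponent \<open>k\<close> with \<open>(I\<^sup>k\<^sup>+\<^sup>1 : I) \<subseteq> I\<^sup>k\<close>.  If all the
  ideals \<open>(I\<^sup>k\<^sup>+\<^sup>1 : f g)\<close> were larger than \<open>p\<close>, the product \<open>H\<close> of elements \<open>h g\<close> that lie in them but not
  in \<open>p\<close> would satisfy \<open>H f I \<subseteq> I\<^sup>k\<^sup>+\<^sup>1\<close>, so that \<open>H f \<in> I\<^sup>k\<close> and \<open>H \<in> p\<close>.
\<close>

lemma prime_colon_lift:
  fixes I :: "('n::finite, 'k::field) mpoly set"
  assumes G: "finite G" "I = Idl\<^bsub>polyring\<^esub> G"
    and cancel: "\<And>f. (\<And>g. g \<in> I \<Longrightarrow> f * g \<in> ideal_power I (Suc k)) \<Longrightarrow> f \<in> ideal_power I k"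
    and p: "primeideal p polyring" "colon (ideal_power I k) f = p"
  shows "\<exists>g\<in>G. colon (ideal_power I (Suc k)) (f * g) = p"
proof (rule ccontr)
  assume none: "\<not> ?thesis"
  have I: "ideal I polyring" unfolding G(2) by (rule ideal_genideal)
  have GI: "G \<subseteq> I" unfolding G(2) by (rule genideal_superset)
  have idk: "ideal (ideal_power I k) polyring" for k by (rule ideal_ideal_power[OF I])
  have "\<exists>h. h * (f * g) \<in> ideal_power I (Suc k) \<and> h \<notin> p" if g: "g \<in> G" for g
  proof -
    have "p \<subseteq> colon (ideal_power I (Suc k)) (f * g)"
    proof
      fix h assume "h \<in> p"
      then have "h * f \<in> ideal_power I k" using p(2) by (auto simp: colon_def)
      then have "h * f * g \<in> ideal_power I (Suc k)"
        unfolding ideal_power_Suc by (rule ideal_prod_mem) (use g GI in blast)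
      then show "h \<in> colon (ideal_power I (Suc k)) (f * g)"
        unfolding colon_def mult.assoc by blast
    qed
    then show ?thesis using none g unfolding colon_def by blast
  qed
  then obtain h where h: "\<And>g. g \<in> G \<Longrightarrow> h g * (f * g) \<in> ideal_power I (Suc k)" "\<And>g. g \<in> G \<Longrightarrow> h g \<notin> p"
    by metis
  define H where "H = prod h G"
  have "H \<notin> p" using prime_prod_mem[OF p(1) G(1)] h(2) unfolding H_def by blast
  define N where "N = {g. g * (H * f) \<in> ideal_power I (Suc k)}"
  have "G \<subseteq> N"
  proof
    fix g assume g: "g \<in> G"
    have "H = h g * prod h (G - {g})" unfolding H_def by (rule prod.remove[OF G(1) g])
    then have "g * (H * f) = prod h (G - {g}) * (h g * (f * g))" by (simp only: mult_ac)
    then show "g \<in> N"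
      unfolding N_def using ideal_mult_left[OF idk h(1)[OF g]] by (metis mem_Collect_eq)
  qed
  moreover have "ideal N polyring"
    using ideal_colon[OF idk[of "Suc k"], of "H * f"] unfolding N_def colon_def .
  ultimately have "I \<subseteq> N" unfolding G(2) by (intro genideal_least)
  then have "g * (H * f) \<in> ideal_power I (Suc k)" if "g \<in> I" for g
    using that unfolding N_def by blast
  then have "H * f * g \<in> ideal_power I (Suc k)" if "g \<in> I" for g
    using that unfolding mult.commute[of "H * f"] by blast
  then have "H * f \<in> ideal_power I k" by (rule cancel)
  then have "H \<in> p" using p(2) by (auto simp: colon_def)
  then show False using \<open>H \<notin> p\<close> by simp
qed

section \<open>Degree bounds\<close>

lemma ideal_min_degree:
  "ideal {f :: ('n::finite, 'k::field) mpoly. \<forall>m\<in>Poly_Mapping.keys f. d \<le> mon_deg m} polyring"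
  unfolding ideal_iff
proof (intro conjI ballI allI)
  fix f g :: "('n, 'k) mpoly"
  assume "f \<in> {f. \<forall>m\<in>Poly_Mapping.keys f. d \<le> mon_deg m}" "g \<in> {f. \<forall>m\<in>Poly_Mapping.keys f. d \<le> mon_deg m}"
  then show "f + g \<in> {f. \<forall>m\<in>Poly_Mapping.keys f. d \<le> mon_deg m}"
    using keys_add[of f g] by blast
next
  fix f r :: "('n, 'k) mpoly"
  assume f: "f \<in> {f. \<forall>m\<in>Poly_Mapping.keys f. d \<le> mon_deg m}"
  show "r * f \<in> {f. \<forall>m\<in>Poly_Mapping.keys f. d \<le> mon_deg m}"
  proof (intro CollectI ballI)
    fix m assume "m \<in> Poly_Mapping.keys (r * f)"
    then obtain u w where "m = u + w" "w \<in> Poly_Mapping.keys f" using keys_mult[of r f] by blast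
    then show "d \<le> mon_deg m" using f by (auto simp: mon_deg_add trans_le_add2)
  qed
qed simp

lemma ideal_power_min_degree:
  assumes G: "G \<subseteq> graded_piece d" "I = Idl\<^bsub>polyring\<^esub> G"
    and f: "f \<in> ideal_power I k" "m \<in> Poly_Mapping.keys f"
  shows "d * k \<le> mon_deg m"
proof -
  have sub: "I \<subseteq> {f. \<forall>m\<in>Poly_Mapping.keys f. d \<le> mon_deg m}"
    unfolding G(2) by (rule genideal_least[OF ideal_min_degree]) (use G(1) in \<open>auto simp: graded_piece_def\<close>)
  have "ideal_power I k \<subseteq> {f. \<forall>m\<in>Poly_Mapping.keys f. d * k \<le> mon_deg m}"
  proof (induction k)
    case (Suc k)
    show ?case unfolding ideal_power_Suc
    proof (rule ideal_prod_subset)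
      fix a b assume a: "a \<in> ideal_power I k" and b: "b \<in> I"
      show "a * b \<in> {f. \<forall>m\<in>Poly_Mapping.keys f. d * Suc k \<le> mon_deg m}"
      proof (intro CollectI ballI)
        fix m assume "m \<in> Poly_Mapping.keys (a * b)"
        then obtain u w where m: "m = u + w" "u \<in> Poly_Mapping.keys a" "w \<in> Poly_Mapping.keys b"
          using keys_mult[of a b] by blast
        have "d * k \<le> mon_deg u" "d \<le> mon_deg w" using Suc a sub b m by blast+
        then show "d * Suc k \<le> mon_deg m" using m(1) by (simp add: mon_deg_add)
      qed
    qed (rule ideal_add[OF ideal_min_degree])
  qed simp
  then show ?thesis using f by blast
qed

lemma initial_degree_eq:
  assumes G: "G \<subseteq> graded_piece d" "I = Idl\<^bsub>polyring\<^esub> G" and I: "I \<noteq> {0}"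
  shows "initial_degree I = d"
  unfolding initial_degree_def
proof (rule Least_equality)
  have "\<not> G \<subseteq> {0}"
  proof
    assume "G \<subseteq> {0}"
    then have "I \<subseteq> {0}" unfolding G(2) by (intro genideal_least) (simp_all add: ideal_iff)
    moreover have "0 \<in> I" unfolding G(2) by (rule ideal_zero[OF ideal_genideal])
    ultimately show False using I by blast
  qed
  then obtain g where g: "g \<in> G" "g \<noteq> 0" by blast
  then have "g \<in> I \<inter> graded_piece d" using G(1) genideal_superset[of G] G(2) by blast
  then show "I \<inter> graded_piece d \<noteq> {0}" using g(2) by blast
next
  fix e assume e: "I \<inter> graded_piece e \<noteq> {0}"
  have "0 \<in> I \<inter> graded_piece e"
    using ideal_zero[OF ideal_genideal, of G] G(2) by (simp add: graded_piece_def)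
  then obtain f where f: "f \<in> I" "f \<in> graded_piece e" "f \<noteq> 0" using e by blast
  have "f ^ 1 \<in> ideal_power I 1" by (rule power_mem_ideal_power[OF f(1)])
  then have "f \<in> ideal_power I 1" unfolding power_one_right .
  moreover obtain m where m: "m \<in> Poly_Mapping.keys f" using f(3) by fastforce
  ultimately have "d * 1 \<le> mon_deg m" by (rule ideal_power_min_degree[OF G])
  then show "d \<le> e" using f(2) m by (auto simp: graded_piece_def)
qed

lemma witness_degree_bound:
  fixes I :: "('n::finite, 'k::field) mpoly set"
  assumes G: "G \<subseteq> graded_piece \<alpha>" "I = Idl\<^bsub>polyring\<^esub> G"
    and p: "primeideal p polyring" "colon (ideal_power I k) f = p"
    and f: "f \<in> graded_piece d" and h: "h \<in> graded_piece e" "h \<in> p" "h \<noteq> 0"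
  shows "\<alpha> * k \<le> d + e"
proof -
  have hf: "h * f \<in> ideal_power I k" using h(2) p(2) by (auto simp: colon_def)
  have "ideal (ideal_power I k) polyring"
    unfolding G(2) by (intro ideal_ideal_power ideal_genideal)
  then have "0 \<in> ideal_power I k" by (rule ideal_zero)
  moreover have "f \<notin> ideal_power I k"
    using one_notin_prime[OF p(1)] unfolding p(2)[symmetric] colon_def by simp
  ultimately have "f \<noteq> 0" by blast
  then have "h * f \<noteq> 0" using mpoly_no_zero_divisors h(3) by blast
  then obtain m where m: "m \<in> Poly_Mapping.keys (h * f)" by fastforce
  have "\<alpha> * k \<le> mon_deg m" by (rule ideal_power_min_degree[OF G hf m])
  moreover have "mon_deg m = e + d"
    using graded_piece_mult[OF h(1) f] m by (auto simp: graded_piece_def)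
  ultimately show ?thesis by simp
qed

lemma prime_contains_variable:
  assumes p: "primeideal p polyring" and m: "Poly_Mapping.single m 1 \<in> (p :: ('n::finite, 'k::field) mpoly set)"
  shows "\<exists>i. Poly_Mapping.single (Poly_Mapping.single i 1) 1 \<in> p"
proof -
  have "Poly_Mapping.keys m \<subseteq> UNIV" by simp
  then show ?thesis using m
  proof (induction m rule: exponent_induct)
    case zero
    then show ?case using one_notin_prime[OF p] by simp
  next
    case (step v u)
    have "Poly_Mapping.single (Poly_Mapping.single v 1 + u) (1::'k) =
      Poly_Mapping.single (Poly_Mapping.single v 1) 1 * Poly_Mapping.single u 1"
      by (simp add: mult_single)
    then show ?case using step prime_mult_mem[OF p] by metis
  qed
qed

lemma eventually_linear:
  fixes v :: "nat \<Rightarrow> nat"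
  assumes step: "\<And>k. k \<ge> K \<Longrightarrow> v (Suc k) \<le> v k + \<alpha>" and bound: "\<And>k. k \<ge> K \<Longrightarrow> \<alpha> * k \<le> v k + c"
  shows "\<exists>b::int. \<forall>\<^sub>F k in sequentially. int (v k) = int \<alpha> * int k + b"
proof -
  define z where "z k = v k + c - \<alpha> * k" for k
  obtain k1 where k1: "k1 \<ge> K" "\<And>k. k \<ge> K \<Longrightarrow> z k1 \<le> z k"
    using ex_has_least_nat[of "\<lambda>k. k \<ge> K" K z] by auto
  have const: "z k = z k1" if "k \<ge> k1" for k
    using that
  proof (induction k rule: dec_induct)
    case (step k)
    then have k: "k \<ge> K" using k1(1) by simp
    have "z (Suc k) \<le> z k"
      using assms(1)[OF k] bound[OF k] by (simp add: z_def)
    then show ?case using step k1(2)[of "Suc k"] k by simp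
  qed simp
  have "int (v k) = int \<alpha> * int k + (int (z k1) - int c)" if "k \<ge> k1" for k
    unfolding const[OF that, symmetric]
    using bound[of k] k1(1) that by (simp add: z_def of_nat_diff)
  then show ?thesis unfolding eventually_sequentially by blast
qed

section \<open>Asymptotic linearity\<close>

theorem theorem2p3:
  fixes I :: "('n::finite, 'k::field) mpoly set"
  assumes "graded_ideal I"
    and "I \<noteq> {0}"
    and "I \<noteq> UNIV"
    and "generated_in_single_degree I"
  shows "\<exists>(b\<^sub>p :: ('n, 'k) mpoly set \<Rightarrow> int) (b :: int).
      (\<forall>p\<in>stable_primes I. \<forall>\<^sub>F k in sequentially.
          int (v_local p (ideal_power I k)) = int (initial_degree I) * int k + b\<^sub>p p)
    \<and> (\<exists>p\<in>stable_primes I. b = b\<^sub>p p) \<and> (\<forall>p\<in>stable_primes I. b \<le> b\<^sub>p p)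
    \<and> (\<forall>\<^sub>F k in sequentially.
          int (v_number (ideal_power I k)) = int (initial_degree I) * int k + b)
    \<and> (monomial_ideal I \<longrightarrow> b \<ge> -1 \<and> (\<forall>p\<in>stable_primes I. b\<^sub>p p \<ge> -1))"
proof -
  have I: "ideal I polyring" using assms(1) by (simp add: graded_ideal_def)
  have idk: "ideal (ideal_power I k) polyring" for k by (rule ideal_ideal_power[OF I])
  obtain \<alpha> G' where G': "G' \<subseteq> graded_piece \<alpha>" "I = Idl\<^bsub>polyring\<^esub> G'"
    using assms(4) unfolding generated_in_single_degree_def by blast
  obtain G where GG: "G \<subseteq> G'" "finite G" "Idl\<^bsub>polyring\<^esub> G' = Idl\<^bsub>polyring\<^esub> G"
    using finite_generating_subset[of G'] by blast
  have G: "G \<subseteq> graded_piece \<alpha>" "I = Idl\<^bsub>polyring\<^esub> G" using G' GG by auto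
  have \<alpha>: "initial_degree I = \<alpha>" by (rule initial_degree_eq[OF G assms(2)])
  obtain a where a: "a \<in> I" "a \<in> graded_piece \<alpha>" "a \<noteq> 0"
  proof -
    have "\<not> G \<subseteq> {0}"
    proof
      assume "G \<subseteq> {0}"
      then have "I \<subseteq> {0}" unfolding G(2) by (intro genideal_least) (simp_all add: ideal_iff)
      then show False using assms(2) ideal_zero[OF I] by blast
    qed
    then show thesis using that G genideal_superset[of G] by blast
  qed
  obtain K where K: "\<forall>k\<ge>K. \<forall>f. (\<forall>g\<in>I. f * g \<in> ideal_power I (Suc k)) \<longrightarrow> f \<in> ideal_power I k"
    using ideal_power_colon_eventually[OF I assms(2)] by blast
  \<comment> \<open>\<open>W p k d\<close>: there is a witness of degree \<open>d\<close> for \<open>p\<close> as an associated prime of \<open>I\<^sup>k\<close>.\<close>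
  define W where "W p k d \<longleftrightarrow> (\<exists>f\<in>graded_piece d. colon (ideal_power I k) f = p)" for p k d
  have v_local: "v_local p (ideal_power I k) = (LEAST d. W p k d)" for p k
    by (simp only: v_local_def W_def)
  have v_number: "v_number (ideal_power I k) = (LEAST d. \<exists>p\<in>Ass (ideal_power I k). W p k d)" for k
    unfolding v_number_def W_def by (rule arg_cong[where f = Least]) blast
  have prime: "primeideal p polyring" if "p \<in> Ass J" for p and J :: "('n, 'k) mpoly set"
    using that by (simp add: Ass_def)
  have Ass_W: "p \<in> Ass (ideal_power I k)" if "primeideal p polyring" "W p k d" for p k d
    using that by (auto simp: Ass_def W_def)
  have W_ex: "\<exists>d. W p k d" if p: "p \<in> Ass (ideal_power I k)" for p k
  proof -
    obtain f where "colon (ideal_power I k) f = p" using p unfolding Ass_def by blast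
    then show ?thesis
      unfolding W_def by (rule homogeneous_witness[OF graded_ideal_power[OF assms(1)] prime[OF p]])
  qed
  have W_step: "W p (Suc k) (d + \<alpha>)" if k: "k \<ge> K" and p: "primeideal p polyring" and W: "W p k d" for p k d
  proof -
    obtain f where f: "f \<in> graded_piece d" "colon (ideal_power I k) f = p" using W by (auto simp: W_def)
    have "\<exists>g\<in>G. colon (ideal_power I (Suc k)) (f * g) = p"
      by (rule prime_colon_lift[OF GG(2) G(2) _ p f(2)]) (use K k in blast)
    then show ?thesis unfolding W_def using graded_piece_mult[OF f(1)] G(1) by blast
  qed
  have W_steps: "W p (k + j) (d + \<alpha> * j)" if "k \<ge> K" "primeideal p polyring" "W p k d" for p k d j
  proof (induction j)
    case 0
    show ?case using that(3) by simp
  next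
    case (Suc j)
    show ?case using W_step[OF _ that(2) Suc] that(1) by (simp add: algebra_simps)
  qed
  have I_sub: "h \<in> p" if "primeideal p polyring" "W p k d" "h \<in> I" for p k d h
  proof -
    have "h ^ k \<in> ideal_power I k" by (rule power_mem_ideal_power[OF that(3)])
    then have "h ^ k \<in> p" using that(2) subset_colon[OF idk] unfolding W_def by blast
    then show ?thesis by (rule prime_mem_of_power_mem[OF that(1)])
  qed
  have bound: "\<alpha> * k \<le> d + e"
    if p: "primeideal p polyring" "W p k d" and h: "h \<in> graded_piece e" "h \<in> p" "h \<noteq> 0" for p k d e h
  proof -
    obtain f where f: "f \<in> graded_piece d" "colon (ideal_power I k) f = p" using p(2) by (auto simp: W_def)
    show ?thesis by (rule witness_degree_bound[OF G p(1) f(2,1) h])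
  qed
  have bound_\<alpha>: "\<alpha> * k \<le> d + \<alpha>" if "primeideal p polyring" "W p k d" for p k d
    using bound[OF that a(2) I_sub[OF that a(1)] a(3)] .

  have local: "\<exists>b::int. \<forall>\<^sub>F k in sequentially. int (v_local p (ideal_power I k)) = int \<alpha> * int k + b"
    if p: "p \<in> stable_primes I" for p
  proof -
    have pp: "primeideal p polyring" using p by (simp add: stable_primes_def)
    obtain N where N: "\<And>k. k \<ge> N \<Longrightarrow> p \<in> Ass (ideal_power I k)"
      using p unfolding stable_primes_def eventually_sequentially by blast
    have att: "W p k (v_local p (ideal_power I k))" if k: "k \<ge> max K N" for k
    proof -
      have "\<exists>d. W p k d" using W_ex[OF N] k by simp
      then obtain d where "W p k d" by blast
      then show ?thesis unfolding v_local by (rule LeastI)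
    qed
    show ?thesis
    proof (rule eventually_linear[of "max K N" _ \<alpha> \<alpha>])
      fix k assume k: "k \<ge> max K N"
      have "W p (Suc k) (v_local p (ideal_power I k) + \<alpha>)"
        using W_step[OF _ pp att[OF k]] k by simp
      then show "v_local p (ideal_power I (Suc k)) \<le> v_local p (ideal_power I k) + \<alpha>"
        unfolding v_local[of p "Suc k"] by (rule Least_le)
      show "\<alpha> * k \<le> v_local p (ideal_power I k) + \<alpha>" by (rule bound_\<alpha>[OF pp att[OF k]])
    qed
  qed
  then obtain b\<^sub>p where bp: "\<And>p. p \<in> stable_primes I \<Longrightarrow>
      \<forall>\<^sub>F k in sequentially. int (v_local p (ideal_power I k)) = int \<alpha> * int k + b\<^sub>p p"
    by metis

  have att: "\<exists>p\<in>Ass (ideal_power I k). W p k (v_number (ideal_power I k))" if k: "k > 0" for k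
  proof -
    have "ideal_power I k \<noteq> UNIV" using ideal_power_subset[OF I k] assms(3) by blast
    then obtain p where p: "p \<in> Ass (ideal_power I k)" using Ass_nonempty[OF idk] by blast
    then obtain d where "W p k d" using W_ex by blast
    then have "\<exists>p\<in>Ass (ideal_power I k). W p k d" using p by blast
    then show ?thesis unfolding v_number by (rule LeastI)
  qed
  have v_le: "v_number (ideal_power I k) \<le> d" if "primeideal p polyring" "W p k d" for p k d
    unfolding v_number using Ass_W[OF that] that(2) by (intro Least_le) blast
  have "\<exists>b::int. \<forall>\<^sub>F k in sequentially. int (v_number (ideal_power I k)) = int \<alpha> * int k + b"
  proof (rule eventually_linear[of "Suc K" _ \<alpha> \<alpha>])
    fix k assume k: "k \<ge> Suc K"
    then obtain p where p: "p \<in> Ass (ideal_power I k)" "W p k (v_number (ideal_power I k))"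
      using att[of k] by auto
    show "v_number (ideal_power I (Suc k)) \<le> v_number (ideal_power I k) + \<alpha>"
      using v_le[OF prime[OF p(1)] W_step[OF _ prime[OF p(1)] p(2)]] k by simp
    show "\<alpha> * k \<le> v_number (ideal_power I k) + \<alpha>" by (rule bound_\<alpha>[OF prime[OF p(1)] p(2)])
  qed
  then obtain b :: int where b: "\<forall>\<^sub>F k in sequentially. int (v_number (ideal_power I k)) = int \<alpha> * int k + b"
    by blast

  have b_le: "b \<le> b\<^sub>p p" if p: "p \<in> stable_primes I" for p
  proof -
    have pp: "primeideal p polyring" and st: "\<forall>\<^sub>F k in sequentially. p \<in> Ass (ideal_power I k)"
      using p by (auto simp: stable_primes_def)
    \<comment> \<open>The quantified exponent does not occur, but \<open>v(I\<^sup>k) \<le> v\<^sub>p(I\<^sup>k)\<close> holds for some large one.\<close>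
    have "\<forall>\<^sub>F k::nat in sequentially. b \<le> b\<^sub>p p"
      using b bp[OF p] st
    proof eventually_elim
      case (elim k)
      then obtain d where "W p k d" using W_ex by blast
      then have "W p k (v_local p (ideal_power I k))" unfolding v_local by (rule LeastI)
      then have "v_number (ideal_power I k) \<le> v_local p (ideal_power I k)" by (rule v_le[OF pp])
      then show ?case using elim(1,2) by linarith
    qed
    then show ?thesis by simp
  qed

  have "\<exists>p\<in>stable_primes I. b = b\<^sub>p p"
  proof -
    obtain N where N: "\<And>k. k \<ge> N \<Longrightarrow> int (v_number (ideal_power I k)) = int \<alpha> * int k + b"
      using b unfolding eventually_sequentially by blast
    \<comment> \<open>A prime attaining \<open>v(I\<^sup>k)\<close> at the single exponent \<open>k = k0\<close> attains it from there on.\<close>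
    define k0 where "k0 = max N (Suc K)"
    have k0: "k0 \<ge> N" "k0 \<ge> K" "k0 > 0" by (auto simp: k0_def)
    obtain p where p: "p \<in> Ass (ideal_power I k0)" "W p k0 (v_number (ideal_power I k0))"
      using att[OF k0(3)] by blast
    note pp = prime[OF p(1)]
    have W: "W p k (v_number (ideal_power I k))" if k: "k \<ge> k0" for k
    proof -
      obtain j where j: "k = k0 + j" using k le_Suc_ex by blast
      have "int (v_number (ideal_power I k)) = int (v_number (ideal_power I k0) + \<alpha> * j)"
        using N[of k0] N[of k] k0(1) unfolding j by (simp add: distrib_left)
      then have "v_number (ideal_power I k) = v_number (ideal_power I k0) + \<alpha> * j" by linarith
      then show ?thesis using W_steps[OF k0(2) pp p(2), of j] j by simp
    qed
    have stable: "p \<in> stable_primes I"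
      unfolding stable_primes_def eventually_sequentially using pp Ass_W[OF pp W] by blast
    have le: "v_local p (ideal_power I k) \<le> v_number (ideal_power I k)" if "k \<ge> k0" for k
      unfolding v_local using W[OF that] by (rule Least_le)
    have "\<forall>\<^sub>F k in sequentially. b\<^sub>p p \<le> b"
      using b bp[OF stable] eventually_ge_at_top[of k0]
    proof eventually_elim
      case (elim k)
      then show ?case using le[of k] by linarith
    qed
    then have "b\<^sub>p p \<le> b" by simp
    then show ?thesis using stable b_le[OF stable] by (intro bexI[of _ p]) auto
  qed
  moreover have "b\<^sub>p p \<ge> -1" if mon: "monomial_ideal I" and p: "p \<in> stable_primes I" for p
  proof -
    have pp: "primeideal p polyring" and st: "\<forall>\<^sub>F k in sequentially. p \<in> Ass (ideal_power I k)"
      using p by (auto simp: stable_primes_def)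
    obtain M where M: "I = Idl\<^bsub>polyring\<^esub> ((\<lambda>m. Poly_Mapping.single m 1) ` M)"
      using mon unfolding monomial_ideal_def by blast
    have "M \<noteq> {}"
    proof
      assume "M = {}"
      then have "I \<subseteq> {0}" unfolding M by (intro genideal_least) (simp_all add: ideal_iff)
      then show False using assms(2) ideal_zero[OF I] by blast
    qed
    then obtain m where m: "Poly_Mapping.single m 1 \<in> I"
      using genideal_superset[of "(\<lambda>m. Poly_Mapping.single m 1) ` M"] unfolding M by blast
    have "\<forall>\<^sub>F k::nat in sequentially. -1 \<le> b\<^sub>p p"
      using bp[OF p] st
    proof eventually_elim
      case (elim k)
      then obtain d where "W p k d" using W_ex by blast
      then have W: "W p k (v_local p (ideal_power I k))" unfolding v_local by (rule LeastI)
      obtain i where i: "Poly_Mapping.single (Poly_Mapping.single i 1) 1 \<in> p"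
        using prime_contains_variable[OF pp I_sub[OF pp W m]] by blast
      have "mon_deg (Poly_Mapping.single i 1) = (\<Sum>j\<in>UNIV. if i = j then 1 else 0)"
        unfolding mon_deg_def by (intro sum.cong) (auto simp: lookup_single)
      then have "Poly_Mapping.single (Poly_Mapping.single i 1) 1 \<in> (graded_piece 1 :: ('n, 'k) mpoly set)"
        by (simp add: graded_piece_def)
      then have "\<alpha> * k \<le> v_local p (ideal_power I k) + 1"
        by (rule bound[OF pp W _ i]) (metis lookup_single_eq lookup_zero one_neq_zero)
      then have "int (\<alpha> * k) \<le> int (v_local p (ideal_power I k)) + 1" by linarith
      then show ?case using elim(1) by simp
    qed
    then show ?thesis by simp
  qed
  ultimately show ?thesis
    unfolding \<alpha> using bp b b_le by (intro exI[of _ b\<^sub>p] exI[of _ b] conjI) auto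
qed

end
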